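(* Let $(M,g)$ be a smooth compact connected Riemannian manifold without boundary of dimension $n\ge2$, and let $C,\Omega\subset M$ be $C^2$ domains satisfying $C\subset\Omega$. Suppose that $x_0\in\partial C\cap\partial\Omega$ and that $\partial C$ and $\partial\Omega$ are tangent at $x_0$. Let $\nu_C$ and $\nu_\Omega$ denote the outward unit normals to $\partial C$ and $\partial\Omega$, respectively. Then $$\nu_C(x_0)=\nu_\Omega(x_0).$$ Moreover, if $\mathrm{II}_C$ and $\mathrm{II}_\Omega$ denote the second fundamental forms of $\partial C$ and $\partial\Omega$, with the convention $\mathrm{II}(X,Y)=g(\nabla_X\nu,Y)$ where $\nu$ is the respective outward unit normal, then $$\mathrm{II}_{\Omega}(x_0)\le\mathrm{II}_{C}(x_0)$$ as quadratic forms on the common tangent space $T_{x_0}\partial C=T_{x_0}\partial\Omega$. Consequently, if the mean curvature of the boundary is defined by $H=\frac{1}{n-1}\operatorname{tr}\mathrm{II}$, the trace being taken with respect to the induced metric on the boundary, then $$H_{\partial\Omega}(x_0)\le H_{\partial C}(x_0).$$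
   Context: $\nabla$ is the Levi-Civita connection of $g$. A $C^2$ domain is a connected open set whose boundary is a $C^2$ embedded hypersurface with the domain lying locally on one side of it. Tangent at $x_0$ means $T_{x_0}\partial C=T_{x_0}\partial\Omega$. *)

theory Defs
  imports "HOL-Analysis.Analysis"
begin

section \<open>Functions of class \<open>C\<^sup>k\<close>\<close>

text \<open>Meant for open \<open>S\<close>: all iterated directional derivatives up to order \<open>k\<close> exist and are
  continuous, which for a Euclidean domain is the usual condition on partial derivatives.\<close>

fun Ck_on :: "nat \<Rightarrow> 'v::real_normed_vector set \<Rightarrow> ('v \<Rightarrow> 'w::real_normed_vector) \<Rightarrow> bool" where
  "Ck_on 0 S f \<longleftrightarrow> continuous_on S f"
| "Ck_on (Suc k) S f \<longleftrightarrow>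
     (\<forall>x\<in>S. f differentiable (at x)) \<and> (\<forall>v. Ck_on k S (\<lambda>x. frechet_derivative f (at x) v))"

section \<open>Smooth manifolds\<close>

text \<open>The manifold is a whole type \<open>'a\<close>, Hausdorff and second countable by its type class; its
  smooth structure is given by an atlas \<open>A\<close>. A chart is a pair of an open set and a coordinate map.
  Charts have open image in \<open>\<real>\<^sup>n\<close>, so there is no boundary.\<close>

type_synonym ('a, 'n) chart = "'a set \<times> ('a \<Rightarrow> real ^ 'n)"

definition chart_inv :: "('a, 'n) chart \<Rightarrow> real ^ 'n \<Rightarrow> 'a" where
  "chart_inv c = inv_into (fst c) (snd c)"

definition is_chart :: "('a::topological_space, 'n::finite) chart \<Rightarrow> bool" where
  "is_chart c \<longleftrightarrow> open (fst c) \<and> open (snd c ` fst c) \<and>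
     homeomorphism (fst c) (snd c ` fst c) (snd c) (chart_inv c)"

definition smooth_atlas ::
    "('a::{t2_space, second_countable_topology}, 'n::finite) chart set \<Rightarrow> bool" where
  "smooth_atlas A \<longleftrightarrow> (\<forall>c\<in>A. is_chart c) \<and> (\<Union>c\<in>A. fst c) = UNIV \<and>
     (\<forall>c\<in>A. \<forall>d\<in>A. \<forall>k. Ck_on k (snd c ` (fst c \<inter> fst d)) (snd d \<circ> chart_inv c))"

text \<open>Tangent spaces are handled as follows: a preferred chart is fixed around each point \<open>p\<close>, and
  \<open>T\<^sub>pM\<close> is identified with \<open>\<real>\<^sup>n\<close> by taking components in that chart. Thus a vector field is a
  function from points to \<open>\<real>\<^sup>n\<close>, but its regularity refers to its components in the
  charts of the atlas, not to this function itself: the preferred chart may jump.\<close>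

definition chart_at :: "('a, 'n) chart set \<Rightarrow> 'a \<Rightarrow> ('a, 'n) chart" where
  "chart_at A p = (SOME c. c \<in> A \<and> p \<in> fst c)"

text \<open>The components in the chart \<open>c\<close> of \<open>v \<in> T\<^sub>pM\<close>, and the tangent vector at \<open>p\<close> whose
  components in the chart \<open>c\<close> are \<open>u\<close>.\<close>

definition components ::
    "('a, 'n::finite) chart set \<Rightarrow> ('a, 'n) chart \<Rightarrow> 'a \<Rightarrow> real ^ 'n \<Rightarrow> real ^ 'n" where
  "components A c p v =
     frechet_derivative (snd c \<circ> chart_inv (chart_at A p)) (at (snd (chart_at A p) p)) v"

definition coord_field ::
    "('a, 'n::finite) chart set \<Rightarrow> ('a, 'n) chart \<Rightarrow> real ^ 'n \<Rightarrow> 'a \<Rightarrow> real ^ 'n" where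
  "coord_field A c u p = frechet_derivative (snd (chart_at A p) \<circ> chart_inv c) (at (snd c p)) u"

definition Ck_fun ::
    "('a, 'n::finite) chart set \<Rightarrow> nat \<Rightarrow> 'a set \<Rightarrow> ('a \<Rightarrow> real) \<Rightarrow> bool" where
  "Ck_fun A k W f \<longleftrightarrow> (\<forall>c\<in>A. Ck_on k (snd c ` (fst c \<inter> W)) (f \<circ> chart_inv c))"

text \<open>The differential \<open>df\<^sub>p(v) = v f\<close>.\<close>

definition differential ::
    "('a, 'n::finite) chart set \<Rightarrow> ('a \<Rightarrow> real) \<Rightarrow> 'a \<Rightarrow> real ^ 'n \<Rightarrow> real" where
  "differential A f p v =
     frechet_derivative (f \<circ> chart_inv (chart_at A p)) (at (snd (chart_at A p) p)) v"

definition local_rep ::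
    "('a, 'n::finite) chart set \<Rightarrow> ('a, 'n) chart \<Rightarrow> ('a \<Rightarrow> real ^ 'n) \<Rightarrow> real ^ 'n \<Rightarrow> real ^ 'n" where
  "local_rep A c X y = components A c (chart_inv c y) (X (chart_inv c y))"

definition Ck_field ::
    "('a, 'n::finite) chart set \<Rightarrow> nat \<Rightarrow> 'a set \<Rightarrow> ('a \<Rightarrow> real ^ 'n) \<Rightarrow> bool" where
  "Ck_field A k W X \<longleftrightarrow> (\<forall>c\<in>A. Ck_on k (snd c ` (fst c \<inter> W)) (local_rep A c X))"

definition lie_bracket ::
    "('a, 'n::finite) chart set \<Rightarrow> ('a \<Rightarrow> real ^ 'n) \<Rightarrow> ('a \<Rightarrow> real ^ 'n) \<Rightarrow> 'a \<Rightarrow> real ^ 'n" where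
  "lie_bracket A X Y p = (let c = chart_at A p in
     frechet_derivative (local_rep A c Y) (at (snd c p)) (X p) -
     frechet_derivative (local_rep A c X) (at (snd c p)) (Y p))"

section \<open>Riemannian metrics and the Levi-Civita connection\<close>

definition riemannian_metric ::
    "('a, 'n::finite) chart set \<Rightarrow> ('a \<Rightarrow> real ^ 'n \<Rightarrow> real ^ 'n \<Rightarrow> real) \<Rightarrow> bool" where
  "riemannian_metric A g \<longleftrightarrow>
     (\<forall>p. bilinear (g p) \<and> (\<forall>u v. g p u v = g p v u) \<and> (\<forall>v. v \<noteq> 0 \<longrightarrow> g p v v > 0)) \<and>
     (\<forall>c\<in>A. \<forall>u v k.
        Ck_on k (snd c ` fst c)
          ((\<lambda>p. g p (coord_field A c u p) (coord_field A c v p)) \<circ> chart_inv c))"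

definition C1_fun_near :: "('a::topological_space, 'n::finite) chart set \<Rightarrow> 'a \<Rightarrow> ('a \<Rightarrow> real) \<Rightarrow> bool" where
  "C1_fun_near A p f \<longleftrightarrow> (\<exists>W. open W \<and> p \<in> W \<and> Ck_fun A 1 W f)"

definition C1_field_near ::
    "('a::topological_space, 'n::finite) chart set \<Rightarrow> 'a \<Rightarrow> ('a \<Rightarrow> real ^ 'n) \<Rightarrow> bool" where
  "C1_field_near A p X \<longleftrightarrow> (\<exists>W. open W \<and> p \<in> W \<and> Ck_field A 1 W X)"

text \<open>\<open>nabla p v X\<close> is the covariant derivative at \<open>p\<close> of the vector field \<open>X\<close> in the direction
  \<open>v \<in> T\<^sub>pM\<close>. The field only has to be \<open>C\<^sup>1\<close> near \<open>p\<close>, because unit normals of \<open>C\<^sup>2\<close>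
  hypersurfaces are no better than \<open>C\<^sup>1\<close>. Locality in \<open>X\<close> follows from the Leibniz rule, applied to
  the indicator function of a neighbourhood of \<open>p\<close>.\<close>

definition affine_connection ::
    "('a::topological_space, 'n::finite) chart set \<Rightarrow>
     ('a \<Rightarrow> real ^ 'n \<Rightarrow> ('a \<Rightarrow> real ^ 'n) \<Rightarrow> real ^ 'n) \<Rightarrow> bool" where
  "affine_connection A nabla \<longleftrightarrow>
     (\<forall>p X. C1_field_near A p X \<longrightarrow> linear (\<lambda>v. nabla p v X)) \<and>
     (\<forall>p v X Y. C1_field_near A p X \<longrightarrow> C1_field_near A p Y \<longrightarrow>
        nabla p v (\<lambda>q. X q + Y q) = nabla p v X + nabla p v Y) \<and>
     (\<forall>p v f X. C1_fun_near A p f \<longrightarrow> C1_field_near A p X \<longrightarrow>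
        nabla p v (\<lambda>q. f q *\<^sub>R X q) = differential A f p v *\<^sub>R X p + f p *\<^sub>R nabla p v X) \<and>
     (\<forall>W X Y. open W \<longrightarrow> (\<forall>k. Ck_field A k W X) \<longrightarrow> (\<forall>k. Ck_field A k W Y) \<longrightarrow>
        (\<forall>k. Ck_field A k W (\<lambda>p. nabla p (X p) Y)))"

definition levi_civita ::
    "('a::topological_space, 'n::finite) chart set \<Rightarrow> ('a \<Rightarrow> real ^ 'n \<Rightarrow> real ^ 'n \<Rightarrow> real) \<Rightarrow>
     ('a \<Rightarrow> real ^ 'n \<Rightarrow> ('a \<Rightarrow> real ^ 'n) \<Rightarrow> real ^ 'n) \<Rightarrow> bool" where
  "levi_civita A g nabla \<longleftrightarrow> affine_connection A nabla \<and>
     (\<forall>p v X Y. C1_field_near A p X \<longrightarrow> C1_field_near A p Y \<longrightarrow>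
        differential A (\<lambda>q. g q (X q) (Y q)) p v = g p (nabla p v X) (Y p) + g p (X p) (nabla p v Y)) \<and>
     (\<forall>p X Y. C1_field_near A p X \<longrightarrow> C1_field_near A p Y \<longrightarrow>
        nabla p (X p) Y - nabla p (Y p) X = lie_bracket A X Y p)"

section \<open>Domains with \<open>C\<^sup>2\<close> boundary\<close>

definition defining_function ::
    "('a::topological_space, 'n::finite) chart set \<Rightarrow> 'a set \<Rightarrow> 'a set \<Rightarrow> ('a \<Rightarrow> real) \<Rightarrow> bool" where
  "defining_function A S W f \<longleftrightarrow> open W \<and> Ck_fun A 2 W f \<and>
     (\<forall>q\<in>W. \<exists>v. differential A f q v \<noteq> 0) \<and> S \<inter> W = {q \<in> W. f q = 0}"

definition C2_hypersurface :: "('a::topological_space, 'n::finite) chart set \<Rightarrow> 'a set \<Rightarrow> bool" where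
  "C2_hypersurface A S \<longleftrightarrow> (\<forall>p\<in>S. \<exists>W f. p \<in> W \<and> defining_function A S W f)"

definition one_sided_defining_function ::
    "('a::topological_space, 'n::finite) chart set \<Rightarrow> 'a set \<Rightarrow> 'a set \<Rightarrow> ('a \<Rightarrow> real) \<Rightarrow> bool" where
  "one_sided_defining_function A D W f \<longleftrightarrow>
     defining_function A (frontier D) W f \<and> D \<inter> W = {q \<in> W. f q < 0}"

definition C2_domain :: "('a::topological_space, 'n::finite) chart set \<Rightarrow> 'a set \<Rightarrow> bool" where
  "C2_domain A D \<longleftrightarrow> open D \<and> connected D \<and> C2_hypersurface A (frontier D) \<and>
     (\<forall>p\<in>frontier D. \<exists>W f. p \<in> W \<and> one_sided_defining_function A D W f)"

text \<open>\<open>T\<^sub>pS\<close>: the velocities at \<open>p\<close> of \<open>C\<^sup>1\<close> curves in \<open>S\<close> through \<open>p\<close>.\<close>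

definition tangent_space ::
    "('a, 'n::finite) chart set \<Rightarrow> 'a set \<Rightarrow> 'a \<Rightarrow> (real ^ 'n) set" where
  "tangent_space A S p = {v. \<exists>\<gamma> e. e > 0 \<and> \<gamma> 0 = p \<and>
     (\<forall>t\<in>{-e<..<e}. \<gamma> t \<in> S \<inter> fst (chart_at A p)) \<and>
     Ck_on 1 {-e<..<e::real} (snd (chart_at A p) \<circ> \<gamma>) \<and>
     ((snd (chart_at A p) \<circ> \<gamma>) has_vector_derivative v) (at 0)}"

definition outward_pointing ::
    "('a::topological_space, 'n::finite) chart set \<Rightarrow> 'a set \<Rightarrow> 'a \<Rightarrow> real ^ 'n \<Rightarrow> bool" where
  "outward_pointing A D p v \<longleftrightarrow>
     (\<exists>W f. p \<in> W \<and> one_sided_defining_function A D W f \<and> differential A f p v > 0)"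

definition outward_unit_normal ::
    "('a::topological_space, 'n::finite) chart set \<Rightarrow> ('a \<Rightarrow> real ^ 'n \<Rightarrow> real ^ 'n \<Rightarrow> real) \<Rightarrow>
     'a set \<Rightarrow> 'a \<Rightarrow> real ^ 'n" where
  "outward_unit_normal A g D p = (THE \<nu>. g p \<nu> \<nu> = 1 \<and>
     (\<forall>v\<in>tangent_space A (frontier D) p. g p \<nu> v = 0) \<and> outward_pointing A D p \<nu>)"

text \<open>The normal field lives on the boundary only; as usual, its covariant derivative in a direction
  tangent to the boundary is that of a local \<open>C\<^sup>1\<close> extension, and does not depend on the choice
  of the extension.\<close>

definition normal_extension ::
    "('a::topological_space, 'n::finite) chart set \<Rightarrow> ('a \<Rightarrow> real ^ 'n \<Rightarrow> real ^ 'n \<Rightarrow> real) \<Rightarrow>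
     'a set \<Rightarrow> 'a \<Rightarrow> 'a \<Rightarrow> real ^ 'n" where
  "normal_extension A g D p = (SOME N. \<exists>W. open W \<and> p \<in> W \<and> Ck_field A 1 W N \<and>
     (\<forall>q\<in>W \<inter> frontier D. N q = outward_unit_normal A g D q))"

definition second_fundamental_form ::
    "('a::topological_space, 'n::finite) chart set \<Rightarrow> ('a \<Rightarrow> real ^ 'n \<Rightarrow> real ^ 'n \<Rightarrow> real) \<Rightarrow>
     ('a \<Rightarrow> real ^ 'n \<Rightarrow> ('a \<Rightarrow> real ^ 'n) \<Rightarrow> real ^ 'n) \<Rightarrow>
     'a set \<Rightarrow> 'a \<Rightarrow> real ^ 'n \<Rightarrow> real ^ 'n \<Rightarrow> real" where
  "second_fundamental_form A g nabla D p X Y = g p (nabla p X (normal_extension A g D p)) Y"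

definition orthonormal_basis ::
    "(real ^ 'n::finite \<Rightarrow> real ^ 'n \<Rightarrow> real) \<Rightarrow> (real ^ 'n) set \<Rightarrow> (real ^ 'n) set \<Rightarrow> bool" where
  "orthonormal_basis b T B \<longleftrightarrow> finite B \<and> span B = T \<and>
     (\<forall>u\<in>B. \<forall>v\<in>B. b u v = (if u = v then 1 else 0))"

definition trace_on ::
    "(real ^ 'n::finite \<Rightarrow> real ^ 'n \<Rightarrow> real) \<Rightarrow> (real ^ 'n) set \<Rightarrow>
     (real ^ 'n \<Rightarrow> real ^ 'n \<Rightarrow> real) \<Rightarrow> real" where
  "trace_on b T q = (\<Sum>e\<in>(SOME B. orthonormal_basis b T B). q e e)"

definition mean_curvature ::
    "('a::topological_space, 'n::finite) chart set \<Rightarrow> ('a \<Rightarrow> real ^ 'n \<Rightarrow> real ^ 'n \<Rightarrow> real) \<Rightarrow>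
     ('a \<Rightarrow> real ^ 'n \<Rightarrow> ('a \<Rightarrow> real ^ 'n) \<Rightarrow> real ^ 'n) \<Rightarrow> 'a set \<Rightarrow> 'a \<Rightarrow> real" where
  "mean_curvature A g nabla D p = 1 / (real CARD('n) - 1) *
     trace_on (g p) (tangent_space A (frontier D) p) (second_fundamental_form A g nabla D p)"

end

theory Submission
  imports Defs
begin

text \<open>
  Why the theorem holds.  Let \<open>f\<close> and \<open>h\<close> be defining functions of \<open>C\<close> and \<open>\<Omega>\<close> near \<open>x0\<close>, negative
  inside.  The tangent space of the boundary is the kernel of the differential
  (\<open>tangent_space_eq_kernel\<close>), so tangency makes \<open>df\<close> and \<open>dh\<close> proportional at \<open>x0\<close>.  A direction
  leading out of \<open>\<Omega>\<close> cannot lead into \<open>C \<subseteq> \<Omega>\<close>, so the factor is positive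
  (\<open>one_sided_differential_mono\<close>) and the outward unit normals, which are the normalised gradients,
  agree; call them \<open>\<nu>\<close>.

  Rescale both functions so that their derivatives in the direction \<open>\<nu>\<close> are \<open>1\<close>.  Then \<open>f - h\<close> has
  a critical zero at \<open>x0\<close>.  On a curve in the boundary of \<open>\<Omega>\<close> with velocity \<open>X\<close> at \<open>x0\<close>, one has
  \<open>h = 0\<close>, and \<open>f \<ge> 0\<close> because this boundary does not meet \<open>C\<close>.  Hence the Hessian of \<open>f - h\<close> at
  \<open>x0\<close> is nonnegative on \<open>X\<close> (\<open>second_derivative_nonneg_along_curve\<close>).

  It remains to see that the difference of the second fundamental forms is the difference of these
  Hessians.  In a chart, \<open>nabla\<close> is the ordinary derivative of the components plus Christoffel terms
  that depend on the value of the field at \<open>x0\<close> only (\<open>nabla_in_chart\<close>).  The two normal fields have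
  the same value there, so these terms cancel.  The derivatives of their components are related to
  the Hessians by differentiating, along a curve in the boundary, the statement that \<open>g(N, _)\<close> is
  proportional to the differential of the defining function; this produces derivatives of the metric
  coefficients, which again depend on \<open>\<nu>\<close> and \<open>X\<close> only and cancel (\<open>normal_derivative_hessian\<close>).

  The traces are taken over one orthonormal basis of the common tangent space, so the inequality of
  quadratic forms can be summed over it.
\<close>

section \<open>Calculus for functions of class \<open>C\<^sup>1\<close>\<close>

lemma has_derivative_cong_open:
  assumes "open S" "x \<in> S" "\<And>y. y \<in> S \<Longrightarrow> f y = h y"
  shows "(f has_derivative D) (at x) \<longleftrightarrow> (h has_derivative D) (at x)"
  using has_derivative_transform_within_open[OF _ assms(1,2)] assms(3) by metis

lemma frechet_derivative_cong_open:
  assumes "open S" "x \<in> S" "\<And>y. y \<in> S \<Longrightarrow> f y = h y"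
  shows "frechet_derivative f (at x) = frechet_derivative h (at x)"
proof -
  have "(f has_derivative D) (at x) \<longleftrightarrow> (h has_derivative D) (at x)" for D
    by (rule has_derivative_cong_open[OF assms])
  then show ?thesis
    by (simp add: frechet_derivative_def)
qed

lemma Ck_on_cong:
  assumes "open S" "\<And>x. x \<in> S \<Longrightarrow> f x = h x"
  shows "Ck_on k S f \<longleftrightarrow> Ck_on k S h"
  using assms(2)
proof (induction k arbitrary: f h)
  case 0
  then show ?case
    by (simp cong: continuous_on_cong)
next
  case (Suc k)
  have "(f has_derivative D) (at x) \<longleftrightarrow> (h has_derivative D) (at x)" if "x \<in> S" for x D
    by (rule has_derivative_cong_open[OF assms(1) that Suc.prems])
  then have "f differentiable (at x) \<longleftrightarrow> h differentiable (at x)" if "x \<in> S" for x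
    using that by (simp add: differentiable_def)
  moreover have "Ck_on k S (\<lambda>x. frechet_derivative f (at x) v) \<longleftrightarrow>
      Ck_on k S (\<lambda>x. frechet_derivative h (at x) v)" for v
  proof (rule Suc.IH)
    show "frechet_derivative f (at x) v = frechet_derivative h (at x) v" if "x \<in> S" for x
      using frechet_derivative_cong_open[OF assms(1) that Suc.prems] by simp
  qed
  ultimately show ?case
    by simp
qed

lemma Ck_on_subset: "Ck_on k S f \<Longrightarrow> T \<subseteq> S \<Longrightarrow> Ck_on k T f"
  by (induction k arbitrary: f) (auto intro: continuous_on_subset)

lemma Ck_on_has_derivative:
  assumes "Ck_on (Suc k) S f" "x \<in> S"
  shows "(f has_derivative frechet_derivative f (at x)) (at x)"
  using assms frechet_derivative_works by auto

lemma Ck_on_continuous: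
  assumes "Ck_on k S f"
  shows "continuous_on S f"
proof (cases k)
  case (Suc j)
  then have "continuous (at x) f" if "x \<in> S" for x
    using assms that by (auto intro: differentiable_imp_continuous_within)
  then show ?thesis
    by (simp add: continuous_at_imp_continuous_on)
qed (use assms in simp)

lemma C1_onI:
  assumes "\<And>x. x \<in> S \<Longrightarrow> (f has_derivative f' x) (at x)"
    and "\<And>v. continuous_on S (\<lambda>x. f' x v)"
  shows "Ck_on 1 S f"
proof -
  have "frechet_derivative f (at x) = f' x" if "x \<in> S" for x
    using assms(1)[OF that] frechet_derivative_at by metis
  then have "continuous_on S (\<lambda>x. frechet_derivative f (at x) v)" for v
    using assms(2)[of v] by (simp cong: continuous_on_cong)
  then show ?thesis
    using assms(1) by (auto simp: differentiable_def)
qed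

lemma C1_onD:
  assumes "Ck_on 1 S f"
  shows "\<And>x. x \<in> S \<Longrightarrow> (f has_derivative frechet_derivative f (at x)) (at x)"
    and "\<And>v. continuous_on S (\<lambda>x. frechet_derivative f (at x) v)"
  using assms frechet_derivative_works by auto

lemma Ck_on_2_imp_1: "Ck_on 2 S f \<Longrightarrow> Ck_on 1 S f"
  by (auto simp: numeral_2_eq_2 intro: Ck_on_continuous[of 1])

lemma C1_bounded_linear:
  assumes "bounded_linear B" "Ck_on 1 S f"
  shows "Ck_on 1 S (\<lambda>x. B (f x))"
  by (rule C1_onI[where f' = "\<lambda>x v. B (frechet_derivative f (at x) v)"])
     (use assms in \<open>auto intro!: bounded_linear.has_derivative[OF assms(1)] C1_onD
        bounded_linear.continuous_on[OF assms(1)] simp del: Ck_on.simps One_nat_def\<close>)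

lemma C1_const: "Ck_on 1 S (\<lambda>x. c)"
  by (rule C1_onI[where f' = "\<lambda>x v. 0"]) auto

lemma C1_bounded_bilinear:
  assumes "bounded_bilinear B" "Ck_on 1 S f" "Ck_on 1 S h"
  shows "Ck_on 1 S (\<lambda>x. B (f x) (h x))"
proof (rule C1_onI)
  show "((\<lambda>x. B (f x) (h x)) has_derivative
     (\<lambda>v. B (f x) (frechet_derivative h (at x) v) + B (frechet_derivative f (at x) v) (h x))) (at x)"
    if "x \<in> S" for x
    by (rule bounded_bilinear.FDERIV[OF assms(1)]) (use that assms C1_onD in auto)
  show "continuous_on S (\<lambda>x. B (f x) (frechet_derivative h (at x) v) +
          B (frechet_derivative f (at x) v) (h x))" for v
    by (intro continuous_on_add bounded_bilinear.continuous_on[OF assms(1)]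
        Ck_on_continuous[OF assms(2)] Ck_on_continuous[OF assms(3)] C1_onD assms)
qed

lemmas C1_scaleR = C1_bounded_bilinear[OF bounded_bilinear_scaleR]
lemmas C1_mult = C1_bounded_bilinear[OF bounded_bilinear_mult]

lemma C1_add:
  assumes "Ck_on 1 S f" "Ck_on 1 S h"
  shows "Ck_on 1 S (\<lambda>x. f x + h x)"
  by (rule C1_onI[where f' = "\<lambda>x v. frechet_derivative f (at x) v + frechet_derivative h (at x) v"])
     (auto intro!: has_derivative_add C1_onD continuous_on_add assms simp del: Ck_on.simps One_nat_def)

lemma C1_sum: "(\<And>i. i \<in> I \<Longrightarrow> Ck_on 1 S (f i)) \<Longrightarrow> Ck_on 1 S (\<lambda>x. \<Sum>i\<in>I. f i x)"
  by (induction I rule: infinite_finite_induct) (auto simp del: Ck_on.simps One_nat_def intro: C1_const C1_add)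

lemma C1_prod:
  fixes f :: "'i \<Rightarrow> 'v::real_normed_vector \<Rightarrow> real"
  shows "(\<And>i. i \<in> I \<Longrightarrow> Ck_on 1 S (f i)) \<Longrightarrow> Ck_on 1 S (\<lambda>x. \<Prod>i\<in>I. f i x)"
  by (induction I rule: infinite_finite_induct) (auto simp del: Ck_on.simps One_nat_def intro: C1_const C1_mult)

lemma C1_compose:
  fixes h :: "'v::euclidean_space \<Rightarrow> 'w::real_normed_vector"
  assumes "Ck_on 1 T h" "Ck_on 1 S f" "f ` S \<subseteq> T"
  shows "Ck_on 1 S (\<lambda>x. h (f x))"
proof (rule C1_onI)
  let ?Df = "\<lambda>x. frechet_derivative f (at x)" and ?Dh = "\<lambda>y. frechet_derivative h (at y)"
  show "((\<lambda>x. h (f x)) has_derivative (\<lambda>v. ?Dh (f x) (?Df x v))) (at x)" if "x \<in> S" for x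
    by (rule has_derivative_compose[OF C1_onD(1)[OF assms(2) that]])
       (use that assms C1_onD(1)[OF assms(1)] in auto)
  have expand: "?Dh (f x) w = (\<Sum>b\<in>Basis. (w \<bullet> b) *\<^sub>R ?Dh (f x) b)" if "x \<in> S" for x w
  proof -
    interpret linear "?Dh (f x)"
      using C1_onD(1)[OF assms(1)] assms(3) that has_derivative_linear by blast
    show ?thesis
      by (subst (1) euclidean_representation[of w, symmetric]) (simp add: sum scale)
  qed
  have "continuous_on S (\<lambda>x. \<Sum>b\<in>Basis. (?Df x v \<bullet> b) *\<^sub>R ?Dh (f x) b)" for v
  proof -
    have "continuous_on S (\<lambda>x. ?Dh (f x) b)" for b
      using continuous_on_compose2[OF C1_onD(2)[OF assms(1)] Ck_on_continuous[OF assms(2)] assms(3)] .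
    then show ?thesis
      by (intro continuous_intros C1_onD(2)[OF assms(2)]) auto
  qed
  then show "continuous_on S (\<lambda>x. ?Dh (f x) (?Df x v))" for v
    by (simp add: expand cong: continuous_on_cong)
qed

lemma C1_inverse:
  fixes f :: "'v::real_normed_vector \<Rightarrow> real"
  assumes "Ck_on 1 S f" "\<And>x. x \<in> S \<Longrightarrow> f x \<noteq> 0"
  shows "Ck_on 1 S (\<lambda>x. inverse (f x))"
  by (rule C1_compose[where T = "- {0}"], rule C1_onI[where f' = "\<lambda>x v. - (inverse x * v * inverse x)"])
     (use assms in \<open>auto intro!: has_derivative_inverse' continuous_intros simp del: Ck_on.simps One_nat_def\<close>)

lemma C1_sqrt:
  fixes f :: "'v::real_normed_vector \<Rightarrow> real"
  assumes "Ck_on 1 S f" "\<And>x. x \<in> S \<Longrightarrow> f x > 0"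
  shows "Ck_on 1 S (\<lambda>x. sqrt (f x))"
proof (rule C1_compose[OF _ assms(1)])
  show "Ck_on 1 {0<..} sqrt"
  proof (rule C1_onI)
    show "(sqrt has_derivative (*) (inverse (sqrt x) / 2)) (at x)" if "x \<in> {0<..}" for x
      using DERIV_real_sqrt[of x] that by (simp add: has_field_derivative_def)
  qed (auto intro!: continuous_intros)
qed (use assms in auto)

lemma vec_expansion: "(\<Sum>i\<in>UNIV. v $ i *\<^sub>R axis i (1::real)) = v"
  using basis_expansion[of v] by (simp add: scalar_mult_eq_scaleR)

lemma C1_vec:
  fixes f :: "'v::real_normed_vector \<Rightarrow> real ^ 'n"
  assumes "\<And>i. Ck_on 1 S (\<lambda>x. f x $ i)"
  shows "Ck_on 1 S f"
proof -
  have "Ck_on 1 S (\<lambda>x. \<Sum>i\<in>UNIV. f x $ i *\<^sub>R axis i (1::real))"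
    using assms by (intro C1_sum C1_scaleR C1_const) auto
  then show ?thesis
    by (simp add: vec_expansion del: Ck_on.simps One_nat_def)
qed

lemmas C1_vec_nth = C1_bounded_linear[OF bounded_linear_vec_nth]

lemma C1_det:
  fixes M :: "'v::real_normed_vector \<Rightarrow> real ^ 'n ^ 'n"
  assumes "\<And>i j. Ck_on 1 S (\<lambda>x. M x $ i $ j)"
  shows "Ck_on 1 S (\<lambda>x. det (M x))"
  unfolding det_def by (intro C1_sum C1_mult C1_const C1_prod assms)

text \<open>By Cramer's rule the solution is a rational function of the entries of \<open>M\<close> and \<open>w\<close>.\<close>

lemma C1_linear_system:
  fixes M :: "'v::real_normed_vector \<Rightarrow> real ^ 'n ^ 'n"
  assumes "\<And>i j. Ck_on 1 S (\<lambda>x. M x $ i $ j)" "\<And>i. Ck_on 1 S (\<lambda>x. w x $ i)"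
    and "\<And>x. x \<in> S \<Longrightarrow> det (M x) \<noteq> 0"
  obtains z where "Ck_on 1 S z" "\<And>x. x \<in> S \<Longrightarrow> M x *v z x = w x"
proof
  define z where "z x = (\<chi> k. det (\<chi> i j. if j = k then w x $ i else M x $ i $ j) * inverse (det (M x)))" for x
  show "Ck_on 1 S z"
  proof (rule C1_vec)
    fix k
    have "Ck_on 1 S (\<lambda>x. if j = k then w x $ i else M x $ i $ j)" for i j
      using assms(1,2) by (cases "j = k") auto
    then show "Ck_on 1 S (\<lambda>x. z x $ k)"
      unfolding z_def vec_lambda_beta
      by (intro C1_mult C1_det C1_inverse assms) auto
  qed
  show "M x *v z x = w x" if "x \<in> S" for x
    using cramer[OF assms(3)[OF that], of "z x" "w x"] by (simp add: z_def field_simps)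
qed

section \<open>Curves in zero sets and second derivatives\<close>

text \<open>The map \<open>\<Phi> y = y + ((F y - F'(p) (y - p)) / |w|\<^sup>2) w\<close>, where \<open>w\<close> is the gradient of \<open>F\<close> at
  \<open>p\<close>, has the identity as its derivative at \<open>p\<close> and straightens the zero set of \<open>F\<close>:
  \<open>w \<bullet> (\<Phi> y - p) = F y\<close>. The curve is the preimage of a straight line under \<open>\<Phi>\<close>.\<close>

lemma curve_in_zero_set:
  fixes F :: "'v::euclidean_space \<Rightarrow> real"
  assumes "open U" "p \<in> U" "Ck_on 1 U F" "F p = 0"
    and nz: "frechet_derivative F (at p) \<noteq> (\<lambda>v. 0)"
    and X: "frechet_derivative F (at p) X = 0"
  obtains \<gamma> e where "e > (0::real)" "\<gamma> 0 = p" "\<And>t. t \<in> {-e<..<e} \<Longrightarrow> \<gamma> t \<in> U \<and> F (\<gamma> t) = 0"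
    "Ck_on 1 {-e<..<e} \<gamma>" "(\<gamma> has_vector_derivative X) (at 0)"
proof -
  let ?D = "\<lambda>y. frechet_derivative F (at y)"
  have der: "(F has_derivative ?D y) (at y)" if "y \<in> U" for y
    using C1_onD(1)[OF assms(3) that] .
  interpret D: bounded_linear "?D p"
    using der[OF assms(2)] by (rule has_derivative_bounded_linear)
  define w where "w = (\<Sum>b\<in>Basis. ?D p b *\<^sub>R b)"
  have w: "?D p v = v \<bullet> w" for v
    by (subst euclidean_representation[of v, symmetric], subst D.sum)
       (simp add: w_def inner_sum_right D.scaleR mult.commute)
  have "w \<noteq> 0"
    using nz w by auto
  define \<Phi> where "\<Phi> y = y + ((F y - (y - p) \<bullet> w) / (w \<bullet> w)) *\<^sub>R w" for y
  define \<Phi>' where "\<Phi>' y v = v + ((?D y v - v \<bullet> w) / (w \<bullet> w)) *\<^sub>R w" for y v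
  have \<Phi>_der: "(\<Phi> has_derivative \<Phi>' y) (at y)" if "y \<in> U" for y
  proof -
    have "((\<lambda>y. (y - p) \<bullet> w) has_derivative (\<lambda>v. v \<bullet> w)) (at y)"
      by (rule derivative_eq_intros refl | simp)+
    then show ?thesis
      unfolding \<Phi>_def \<Phi>'_def
      by (intro has_derivative_add has_derivative_ident has_derivative_scaleR_left
          bounded_linear.has_derivative[OF bounded_linear_divide] has_derivative_diff der that)
  qed
  have \<Phi>'_bl: "bounded_linear (\<Phi>' y)" if "y \<in> U" for y
    using \<Phi>_der[OF that] by (rule has_derivative_bounded_linear)
  have bapp: "blinfun_apply (Blinfun (\<Phi>' y)) = \<Phi>' y" if "y \<in> U" for y
    using \<Phi>'_bl[OF that] by (rule bounded_linear_Blinfun_apply)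
  have cont\<Phi>': "continuous_on U (\<lambda>y. \<Phi>' y v)" for v
    unfolding \<Phi>'_def using \<open>w \<noteq> 0\<close> by (intro continuous_intros C1_onD(2)[OF assms(3)]) auto
  have c: "continuous_on U (\<lambda>y. Blinfun (\<Phi>' y))"
    by (rule continuous_on_blinfun_componentwise)
       (use cont\<Phi>' in \<open>simp add: bapp cong: continuous_on_cong\<close>)
  have \<Phi>'p: "\<Phi>' p v = v" for v
    by (simp add: \<Phi>'_def w)
  have i: "id_blinfun o\<^sub>L Blinfun (\<Phi>' p) = id_blinfun"
    by (rule blinfun_eqI) (simp add: bapp assms(2) \<Phi>'p)
  have \<Phi>_der': "(\<Phi> has_derivative blinfun_apply (Blinfun (\<Phi>' y))) (at y)" if "y \<in> U" for y
    using \<Phi>_der[OF that] bapp[OF that] by simp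
  obtain U' V g g' where g: "open U'" "U' \<subseteq> U" "p \<in> U'" "open V" "\<Phi> p \<in> V" "homeomorphism U' V \<Phi> g"
    "\<And>y. y \<in> V \<Longrightarrow> (g has_derivative (g' y)) (at y)"
    "\<And>y. y \<in> V \<Longrightarrow> g' y = inv (blinfun_apply (Blinfun (\<Phi>' (g y))))"
    "\<And>y. y \<in> V \<Longrightarrow> bij (blinfun_apply (Blinfun (\<Phi>' (g y))))"
    by (rule inverse_function_theorem[OF assms(1) \<Phi>_der' c assms(2) i], assumption) (rule that; simp)
  have \<Phi>p: "\<Phi> p = p"
    by (simp add: \<Phi>_def assms(4))
  have gV: "g y \<in> U'" "\<Phi> (g y) = y" if "y \<in> V" for y
    using g(6) that by (auto simp: homeomorphism_def)
  have "open ((\<lambda>t::real. p + t *\<^sub>R X) -` V)"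
    by (intro open_vimage \<open>open V\<close> continuous_intros)
  moreover have "0 \<in> (\<lambda>t::real. p + t *\<^sub>R X) -` V"
    using g(5) by (simp add: \<Phi>p)
  ultimately obtain e where e: "e > 0" "ball 0 e \<subseteq> (\<lambda>t::real. p + t *\<^sub>R X) -` V"
    using open_contains_ball by meson
  have eV: "p + t *\<^sub>R X \<in> V" if "t \<in> {-e<..<e}" for t
    using e(2) that by (auto simp: subset_iff)
  define \<gamma> where "\<gamma> t = g (p + t *\<^sub>R X)" for t
  have F\<Phi>: "F y = (\<Phi> y - p) \<bullet> w" for y
    using \<open>w \<noteq> 0\<close> by (simp add: \<Phi>_def inner_left_distrib inner_diff_left)
  have \<gamma>UF: "\<gamma> t \<in> U \<and> F (\<gamma> t) = 0" if "t \<in> {-e<..<e}" for t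
    using gV[OF eV[OF that]] g(2) F\<Phi>[of "\<gamma> t"] w[of X] X by (auto simp: \<gamma>_def)
  \<comment> \<open>The derivative of \<open>g\<close> is only known as an inverse map.  Solving \<open>\<Phi>' (g y) u = X\<close> for \<open>u\<close> yields a
    formula from which the continuity of the velocity can be read off.\<close>
  define \<gamma>' where "\<gamma>' t = X - (?D (\<gamma> t) X / ?D (\<gamma> t) w) *\<^sub>R w" for t
  have \<gamma>_der: "?D (\<gamma> t) w \<noteq> 0 \<and> (\<gamma> has_derivative (\<lambda>s. s *\<^sub>R \<gamma>' t)) (at t)"
    if t: "t \<in> {-e<..<e}" for t
  proof
    let ?y = "p + t *\<^sub>R X"
    have yU: "g ?y \<in> U"
      using gV[OF eV[OF t]] g(2) by auto
    have lD: "linear (?D (g ?y))"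
      using der[OF yU] has_derivative_linear by blast
    have bij: "bij (\<Phi>' (g ?y))" and g': "g' ?y = inv (\<Phi>' (g ?y))"
      using g(8,9)[OF eV[OF t]] bapp[OF yU] by auto
    show Dw: "?D (\<gamma> t) w \<noteq> 0"
    proof
      assume "?D (\<gamma> t) w = 0"
      then have "\<Phi>' (g ?y) w = \<Phi>' (g ?y) 0"
        using \<open>w \<noteq> 0\<close> lD by (simp add: \<Phi>'_def \<gamma>_def linear_0)
      then show False
        using bij \<open>w \<noteq> 0\<close> by (metis bij_def injD)
    qed
    define u where "u = g' ?y X"
    have "\<Phi>' (g ?y) u = X"
      using bij g' by (simp add: u_def bij_is_surj surj_f_inv_f)
    then have *: "u + ((?D (g ?y) u - u \<bullet> w) / (w \<bullet> w)) *\<^sub>R w = X"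
      by (simp add: \<Phi>'_def)
    then have "(u + ((?D (g ?y) u - u \<bullet> w) / (w \<bullet> w)) *\<^sub>R w) \<bullet> w = 0"
      using w[of X] X by simp
    then have Du: "?D (g ?y) u = 0"
      using \<open>w \<noteq> 0\<close> by (simp add: inner_left_distrib)
    define k where "k = (u \<bullet> w) / (w \<bullet> w)"
    have u: "u = X + k *\<^sub>R w"
      using * Du by (simp add: k_def algebra_simps)
    then have "?D (g ?y) X + k * ?D (g ?y) w = 0"
      using Du lD by (simp add: linear_add linear_scale)
    then have "k = - (?D (g ?y) X / ?D (g ?y) w)"
      using Dw by (simp add: \<gamma>_def field_simps)
    then have "u = \<gamma>' t"
      using u by (simp add: \<gamma>'_def \<gamma>_def)
    moreover have "((\<lambda>t. p + t *\<^sub>R X) has_derivative (\<lambda>s. s *\<^sub>R X)) (at t)"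
      by (rule derivative_eq_intros refl | simp)+
    from has_derivative_compose[OF this, where g = g, of "g' ?y"]
    have "(\<gamma> has_derivative (\<lambda>s. g' ?y (s *\<^sub>R X))) (at t)"
      using g(7)[OF eV[OF t]] by (simp add: \<gamma>_def[abs_def])
    ultimately show "(\<gamma> has_derivative (\<lambda>s. s *\<^sub>R \<gamma>' t)) (at t)"
      using g(7)[OF eV[OF t]] by (simp add: u_def linear_scale has_derivative_linear)
  qed
  have cont\<gamma>: "continuous_on {-e<..<e} \<gamma>"
    using \<gamma>_der has_derivative_continuous continuous_at_imp_continuous_on by blast
  have "continuous_on {-e<..<e} (\<lambda>t. ?D (\<gamma> t) v)" for v
    by (rule continuous_on_compose2[OF C1_onD(2)[OF assms(3)] cont\<gamma>]) (use \<gamma>UF in auto)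
  then have "continuous_on {-e<..<e} (\<lambda>t. s *\<^sub>R \<gamma>' t)" for s
    unfolding \<gamma>'_def using \<gamma>_der by (intro continuous_intros) auto
  then have "Ck_on 1 {-e<..<e} \<gamma>"
    using \<gamma>_der by (intro C1_onI) auto
  moreover have "\<gamma> 0 = p"
  proof -
    have "\<Phi> p = p + 0 *\<^sub>R X" by (simp add: \<Phi>p)
    then show ?thesis
      using g(3,6) by (metis \<gamma>_def homeomorphism_def)
  qed
  moreover from this have "(\<gamma> has_vector_derivative X) (at 0)"
    using \<gamma>_der[of 0] e(1) X by (simp add: \<gamma>'_def has_vector_derivative_def)
  ultimately show ?thesis
    using that e(1) \<gamma>UF by blast
qed

text \<open>By the mean value theorem some \<open>s \<in> (0, 1)\<close> satisfies \<open>H' (p + s h) h \<ge> 0\<close> for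
  \<open>h = \<gamma> t - p\<close>, and \<open>H' (p + s h) h = s (H'' h h + o(|h|\<^sup>2))\<close>.  The unknown factor \<open>s\<close> is harmless
  because only signs matter.\<close>

lemma second_derivative_nonneg_along_curve:
  fixes H :: "'v::euclidean_space \<Rightarrow> real"
  assumes "open U" "p \<in> U"
    and H': "\<And>y. y \<in> U \<Longrightarrow> (H has_derivative H' y) (at y)"
    and H'': "\<And>v. ((\<lambda>y. H' y v) has_derivative (\<lambda>u. H'' u v)) (at p)"
    and crit: "H p = 0" "\<And>v. H' p v = 0"
    and curve: "\<gamma> 0 = p" "(\<gamma> has_vector_derivative X) (at 0)"
    and nonneg: "e > 0" "\<And>t. \<bar>t\<bar> < e \<Longrightarrow> H (\<gamma> t) \<ge> 0"
  shows "H'' X X \<ge> 0"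
proof -
  define n where "n y = (\<Sum>b\<in>Basis. H' y b *\<^sub>R b)" for y
  define N where "N u = (\<Sum>b\<in>Basis. H'' u b *\<^sub>R b)" for u
  have n: "H' y v = v \<bullet> n y" if "y \<in> U" for y v
  proof -
    interpret linear "H' y"
      using H'[OF that] has_derivative_linear by blast
    show ?thesis
      by (subst euclidean_representation[of v, symmetric], subst sum)
         (simp add: n_def inner_sum_right scale mult.commute)
  qed
  have n_der: "(n has_derivative N) (at p)"
    unfolding n_def N_def by (intro has_derivative_sum has_derivative_scaleR_left H'')
  then interpret N: bounded_linear N
    by (rule has_derivative_bounded_linear)
  have "n p = 0"
    by (simp add: n_def crit)
  have "((\<lambda>y. X \<bullet> n y) has_derivative (\<lambda>u. H'' u X)) (at p)"
    by (rule has_derivative_transform_within_open[OF H''[of X] assms(1,2)]) (simp add: n)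
  moreover have "((\<lambda>y. X \<bullet> n y) has_derivative (\<lambda>u. X \<bullet> N u)) (at p)"
    by (intro has_derivative_inner_right n_der)
  ultimately have XN: "H'' X X = X \<bullet> N X"
    using has_derivative_unique by metis
  define h where "h t = (\<gamma> t - p) /\<^sub>R t" for t
  have lim: "(h \<longlongrightarrow> X) (at_right 0)"
  proof (rule Lim_transform_eventually)
    have "((\<lambda>t. (1 / norm (t - 0)) *\<^sub>R (\<gamma> t - (\<gamma> 0 + (t - 0) *\<^sub>R X))) \<longlongrightarrow> 0) (at_right 0)"
      using curve(2) has_derivative_at_withinI
      unfolding has_vector_derivative_def has_derivative_within by blast
    then have "((\<lambda>t. X + (1 / norm (t - 0)) *\<^sub>R (\<gamma> t - (\<gamma> 0 + (t - 0) *\<^sub>R X))) \<longlongrightarrow> X + 0) (at_right 0)"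
      by (intro tendsto_add tendsto_const)
    then show "((\<lambda>t. X + (1 / norm (t - 0)) *\<^sub>R (\<gamma> t - (\<gamma> 0 + (t - 0) *\<^sub>R X))) \<longlongrightarrow> X) (at_right 0)"
      by simp
    show "\<forall>\<^sub>F t in at_right 0. X + (1 / norm (t - 0)) *\<^sub>R (\<gamma> t - (\<gamma> 0 + (t - 0) *\<^sub>R X)) = h t"
      using eventually_at_right_less[of 0]
      by eventually_elim (simp add: h_def curve(1) algebra_simps divide_inverse)
  qed
  have \<gamma>lim: "(\<gamma> \<longlongrightarrow> p) (at_right 0)"
    using has_vector_derivative_continuous[OF curve(2)] curve(1)
    unfolding continuous_at filterlim_at_split by simp
  have "0 \<le> X \<bullet> N X + \<epsilon> * (X \<bullet> X)" if "\<epsilon> > 0" for \<epsilon>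
  proof -
    obtain \<delta>1 where \<delta>1: "\<delta>1 > 0" "\<And>k. norm k < \<delta>1 \<Longrightarrow> norm (n (p + k) - N k) \<le> \<epsilon> * norm k"
      using n_der \<open>\<epsilon> > 0\<close> \<open>n p = 0\<close> unfolding has_derivative_at_alt
      by (metis add_diff_cancel_left' diff_zero)
    obtain \<delta>2 where \<delta>2: "\<delta>2 > 0" "ball p \<delta>2 \<subseteq> U"
      using assms(1,2) open_contains_ball by metis
    have pos: "0 \<le> k \<bullet> N k + \<epsilon> * (k \<bullet> k)"
      if k: "norm k < \<delta>1" "norm k < \<delta>2" "H (p + k) \<ge> 0" for k
    proof -
      have der: "((\<lambda>s. H (p + s *\<^sub>R k)) has_derivative (\<lambda>d. d * (k \<bullet> n (p + s *\<^sub>R k)))) (at s within {0..1})"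
        if s: "0 \<le> s" "s \<le> 1" for s :: real
      proof -
        have "norm (s *\<^sub>R k) < \<delta>2"
          using s k mult_left_le_one_le[of "norm k" s] by simp
        then have U: "p + s *\<^sub>R k \<in> U"
          using \<delta>2 by (auto simp: subset_iff dist_norm)
        have "((\<lambda>s. p + s *\<^sub>R k) has_derivative (\<lambda>d. d *\<^sub>R k)) (at s)"
          by (rule derivative_eq_intros refl | simp)+
        from has_derivative_compose[OF this H'[OF U]] show ?thesis
          by (simp add: n[OF U] has_derivative_at_withinI)
      qed
      obtain s where s: "0 < s" "s < 1" "H (p + k) - H p = k \<bullet> n (p + s *\<^sub>R k)"
        using mvt_simple[OF zero_less_one der] by auto
      have "norm (s *\<^sub>R k) < \<delta>1"
        using s k mult_left_le_one_le[of "norm k" s] by simp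
      from \<delta>1(2)[OF this] have r: "norm (n (p + s *\<^sub>R k) - s *\<^sub>R N k) \<le> \<epsilon> * (s * norm k)"
        using s by (simp add: N.scaleR)
      have "k \<bullet> (n (p + s *\<^sub>R k) - s *\<^sub>R N k) \<le> norm k * (\<epsilon> * (s * norm k))"
        by (rule order_trans[OF norm_cauchy_schwarz mult_left_mono[OF r]]) simp
      also have "\<dots> = s * (\<epsilon> * (k \<bullet> k))"
        by (simp add: power2_norm_eq_inner[symmetric] power2_eq_square)
      finally have "0 \<le> s * (k \<bullet> N k + \<epsilon> * (k \<bullet> k))"
        using s(3) k(3) crit(1) by (simp add: inner_diff_right algebra_simps)
      then show ?thesis
        using s(1) by (simp add: zero_le_mult_iff)
    qed
    have "\<forall>\<^sub>F t in at_right 0. dist (\<gamma> t) p < min \<delta>1 \<delta>2"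
      using \<gamma>lim \<delta>1 \<delta>2 by (intro tendstoD) auto
    moreover have "\<forall>\<^sub>F t in at_right 0. t < e"
      using nonneg(1) by (rule eventually_at_right_real[THEN eventually_mono]) auto
    ultimately have "\<forall>\<^sub>F t in at_right 0. 0 \<le> h t \<bullet> N (h t) + \<epsilon> * (h t \<bullet> h t)"
      using eventually_at_right_less[of 0]
    proof eventually_elim
      case (elim t)
      then have "0 \<le> (\<gamma> t - p) \<bullet> N (\<gamma> t - p) + \<epsilon> * ((\<gamma> t - p) \<bullet> (\<gamma> t - p))"
        using nonneg(2)[of t] by (intro pos) (auto simp: dist_norm)
      moreover have "\<gamma> t - p = t *\<^sub>R h t"
        using elim by (simp add: h_def)
      ultimately have "0 \<le> (t * t) * (h t \<bullet> N (h t) + \<epsilon> * (h t \<bullet> h t))"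
        by (simp add: N.scaleR algebra_simps)
      moreover have "0 < t * t"
        using elim by simp
      ultimately show ?case
        using mult_le_cancel_left_pos[of "t * t" 0] by simp
    qed
    moreover have "((\<lambda>t. h t \<bullet> N (h t) + \<epsilon> * (h t \<bullet> h t)) \<longlongrightarrow> X \<bullet> N X + \<epsilon> * (X \<bullet> X)) (at_right 0)"
      by (intro tendsto_intros lim N.tendsto)
    ultimately show ?thesis
      by (intro tendsto_lowerbound) auto
  qed
  moreover have "((\<lambda>\<epsilon>. X \<bullet> N X + \<epsilon> * (X \<bullet> X)) \<longlongrightarrow> X \<bullet> N X + 0 * (X \<bullet> X)) (at_right 0)"
    by (intro tendsto_intros)
  ultimately have "0 \<le> X \<bullet> N X + 0 * (X \<bullet> X)"
    by (intro tendsto_lowerbound[where F = "at_right 0"])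
       (auto intro: eventually_at_right_less[THEN eventually_mono])
  then show ?thesis
    by (simp add: XN)
qed

section \<open>Orthonormal bases\<close>

text \<open>Gram-Schmidt orthogonalisation with respect to \<open>b\<close>.  It ensures that the basis chosen in
  \<open>trace_on\<close> really is an orthonormal basis.\<close>

lemma orthonormal_basis_exists:
  fixes b :: "real ^ 'n::finite \<Rightarrow> real ^ 'n \<Rightarrow> real"
  assumes bil: "bilinear b" and sym: "\<And>u v. b u v = b v u" and pos: "\<And>v. v \<noteq> 0 \<Longrightarrow> b v v > 0"
    and "subspace T"
  shows "\<exists>B. orthonormal_basis b T B"
proof -
  have "\<exists>B. orthonormal_basis b (span S) B" if "finite S" for S
    using that
  proof (induction S)
    case empty
    then show ?case
      by (intro exI[of _ "{}"]) (simp add: orthonormal_basis_def)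
  next
    case (insert a S)
    then obtain B where B: "finite B" "span B = span S"
      "\<And>u v. u \<in> B \<Longrightarrow> v \<in> B \<Longrightarrow> b u v = (if u = v then 1 else 0)"
      by (auto simp: orthonormal_basis_def)
    show ?case
    proof (cases "a \<in> span B")
      case True
      then have "span (insert a S) = span B"
        using B(2) span_redundant[OF True] by (simp add: span_insert)
      then show ?thesis
        using B by (intro exI[of _ B]) (auto simp: orthonormal_basis_def)
    next
      case False
      interpret l: linear "\<lambda>u. b u v" for v
        using bil by (simp add: bilinear_def)
      define s where "s = (\<Sum>e\<in>B. b a e *\<^sub>R e)"
      define w where "w = a - s"
      define k where "k = 1 / sqrt (b w w)"
      define e where "e = k *\<^sub>R w"
      have "s \<in> span B"
        unfolding s_def by (intro span_sum span_scale span_base)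
      have "w \<noteq> 0"
        using False \<open>s \<in> span B\<close> by (auto simp: w_def)
      have ww: "b w w > 0"
        using pos[OF \<open>w \<noteq> 0\<close>] .
      have k: "k > 0" "k * k * b w w = 1"
        using ww by (simp_all add: k_def field_simps)
      have "b s v = b a v" if "v \<in> B" for v
      proof -
        have "b s v = (\<Sum>e\<in>B. b a e * b e v)"
          by (simp add: s_def l.sum l.scale)
        also have "\<dots> = (\<Sum>e\<in>B. if e = v then b a v else 0)"
          by (rule sum.cong) (use that B(3) in auto)
        finally show ?thesis
          using B(1) that by simp
      qed
      then have ev: "b e v = 0" "b v e = 0" if "v \<in> B" for v
        using that by (simp_all add: e_def l.scale w_def l.diff sym[of v])
      have ee: "b e e = 1"
        using k(2) bil by (simp add: e_def bilinear_lmul bilinear_rmul)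
      have "span (insert e B) = span (insert w B)"
      proof -
        have "w = (1 / k) *\<^sub>R e"
          using k(1) by (simp add: e_def)
        then have "w \<in> span (insert e B)"
          by (metis insertI1 span_base span_scale)
        moreover have "e \<in> span (insert w B)"
          unfolding e_def by (intro span_scale span_base) simp
        ultimately show ?thesis
          unfolding span_eq by (auto intro: span_base)
      qed
      also have "\<dots> = span (insert a B)"
        by (rule eq_span_insert_eq) (use \<open>s \<in> span B\<close> in \<open>simp add: w_def span_neg\<close>)
      also have "\<dots> = span (insert a S)"
        using B(2) by (simp add: span_insert)
      finally have "span (insert e B) = span (insert a S)" .
      moreover have "e \<notin> B"
        using ev[of e] ee by force
      ultimately show ?thesis
        using B ev ee by (intro exI[of _ "insert e B"]) (auto simp: orthonormal_basis_def)
    qed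
  qed
  then show ?thesis
    using assms(4) by (metis basis_exists finiteI_independent span_subspace)
qed

section \<open>Changes of charts\<close>

locale manifold =
  fixes A :: "('a::{t2_space, second_countable_topology}, 'n::finite) chart set"
  assumes atlas: "smooth_atlas A"
begin

lemma chart_at [simp]: "chart_at A p \<in> A" "p \<in> fst (chart_at A p)"
proof -
  have "p \<in> (\<Union>c\<in>A. fst c)"
    using atlas by (simp add: smooth_atlas_def)
  then have "\<exists>c. c \<in> A \<and> p \<in> fst c"
    by blast
  then show "chart_at A p \<in> A" "p \<in> fst (chart_at A p)"
    unfolding chart_at_def by (metis (mono_tags, lifting) someI_ex)+
qed

lemma chart_homeomorphism:
  assumes "c \<in> A"
  shows "open (fst c)" "open (snd c ` fst c)" "homeomorphism (fst c) (snd c ` fst c) (snd c) (chart_inv c)"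
  using assms atlas by (auto simp: smooth_atlas_def is_chart_def)

lemma chart_inv_chart [simp]: "c \<in> A \<Longrightarrow> q \<in> fst c \<Longrightarrow> chart_inv c (snd c q) = q"
  using chart_homeomorphism(3) by (metis homeomorphism_apply1)

lemma chart_chart_inv [simp]:
  "c \<in> A \<Longrightarrow> y \<in> snd c ` fst c \<Longrightarrow> snd c (chart_inv c y) = y"
  "c \<in> A \<Longrightarrow> y \<in> snd c ` fst c \<Longrightarrow> chart_inv c y \<in> fst c"
  by auto

lemma open_chart_image:
  assumes "c \<in> A" "open W"
  shows "open (snd c ` (fst c \<inter> W))"
  using homeomorphism_imp_open_map[OF chart_homeomorphism(3)[OF assms(1)], of "fst c \<inter> W"]
    chart_homeomorphism(2)[OF assms(1)] assms(2) openin_open_trans openin_open_Int by blast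

lemma in_chart_image:
  assumes "c \<in> A"
  shows "y \<in> snd c ` (fst c \<inter> W) \<longleftrightarrow> y \<in> snd c ` fst c \<and> chart_inv c y \<in> W"
  using assms by auto

text \<open>The Jacobian of a transition map.  Both \<open>components\<close> and \<open>coord_field\<close> are instances, so all
  changes of charts are governed by the cocycle rule \<open>trans_trans\<close>.\<close>

definition trans :: "('a, 'n) chart \<Rightarrow> ('a, 'n) chart \<Rightarrow> 'a \<Rightarrow> real ^ 'n \<Rightarrow> real ^ 'n" where
  "trans c d q = frechet_derivative (snd d \<circ> chart_inv c) (at (snd c q))"

lemma components_eq_trans: "components A c q = trans (chart_at A q) c q"
  by (simp add: components_def trans_def fun_eq_iff)

lemma coord_field_eq_trans: "coord_field A c u q = trans c (chart_at A q) q u"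
  by (simp add: coord_field_def trans_def)

lemma transition_Ck:
  assumes "c \<in> A" "d \<in> A"
  shows "Ck_on k (snd c ` (fst c \<inter> fst d)) (snd d \<circ> chart_inv c)"
  using atlas assms by (auto simp: smooth_atlas_def)

lemma trans_has_derivative:
  assumes "c \<in> A" "d \<in> A" "q \<in> fst c" "q \<in> fst d"
  shows "((snd d \<circ> chart_inv c) has_derivative trans c d q) (at (snd c q))"
  unfolding trans_def by (rule Ck_on_has_derivative[OF transition_Ck]) (use assms in auto)

lemma linear_trans:
  assumes "c \<in> A" "d \<in> A" "q \<in> fst c" "q \<in> fst d"
  shows "linear (trans c d q)"
  using trans_has_derivative[OF assms] by (rule has_derivative_linear)

lemma linear_components: "c \<in> A \<Longrightarrow> q \<in> fst c \<Longrightarrow> linear (components A c q)"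
  by (simp add: components_eq_trans linear_trans)

lemma linear_coord_field: "c \<in> A \<Longrightarrow> q \<in> fst c \<Longrightarrow> linear (\<lambda>u. coord_field A c u q)"
  by (simp add: coord_field_eq_trans linear_trans)

lemma change_chart_has_derivative:
  assumes "c \<in> A" "d \<in> A" "q \<in> fst c" "q \<in> fst d"
    and "((f \<circ> chart_inv d) has_derivative f') (at (snd d q))"
  shows "((f \<circ> chart_inv c) has_derivative (\<lambda>v. f' (trans c d q v))) (at (snd c q))"
proof (rule has_derivative_transform_within_open)
  let ?S = "snd c ` (fst c \<inter> fst d)"
  show "((\<lambda>y. (f \<circ> chart_inv d) ((snd d \<circ> chart_inv c) y)) has_derivative
      (\<lambda>v. f' (trans c d q v))) (at (snd c q))"
    by (rule has_derivative_compose[OF trans_has_derivative]) (use assms in \<open>simp_all add: comp_def\<close>)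
  show "open ?S"
    using assms by (intro open_chart_image chart_homeomorphism)
qed (use assms in auto)

lemma trans_trans:
  assumes "c \<in> A" "d \<in> A" "e \<in> A" "q \<in> fst c" "q \<in> fst d" "q \<in> fst e"
  shows "trans d e q (trans c d q v) = trans c e q v"
  using change_chart_has_derivative[OF assms(1,2,4,5) trans_has_derivative[OF assms(2,3,5,6)]]
    trans_has_derivative[OF assms(1,3,4,6)] has_derivative_unique by metis

lemma trans_refl:
  assumes "c \<in> A" "q \<in> fst c"
  shows "trans c c q v = v"
proof -
  have "((\<lambda>y. y) has_derivative trans c c q) (at (snd c q))"
    by (rule has_derivative_transform_within_open[OF trans_has_derivative chart_homeomorphism(2)[OF assms(1)]])
       (use assms in auto)
  then have "trans c c q = (\<lambda>v. v)"
    using has_derivative_ident has_derivative_unique by blast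
  then show ?thesis
    by simp
qed

lemma components_coord_field [simp]:
  "c \<in> A \<Longrightarrow> q \<in> fst c \<Longrightarrow> components A c q (coord_field A c u q) = u"
  "c \<in> A \<Longrightarrow> q \<in> fst c \<Longrightarrow> coord_field A c (components A c q v) q = v"
  by (simp_all add: components_eq_trans coord_field_eq_trans trans_trans trans_refl)

lemma components_chart_at [simp]: "components A (chart_at A p) p v = v"
  and coord_field_chart_at [simp]: "coord_field A (chart_at A p) v p = v"
  by (simp_all add: components_eq_trans coord_field_eq_trans trans_refl)

lemma Ck_fun_chart:
  "Ck_fun A k W f \<Longrightarrow> c \<in> A \<Longrightarrow> Ck_on k (snd c ` (fst c \<inter> W)) (f \<circ> chart_inv c)"
  by (simp add: Ck_fun_def)

lemma Ck_field_chart: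
  "Ck_field A k W X \<Longrightarrow> c \<in> A \<Longrightarrow> Ck_on k (snd c ` (fst c \<inter> W)) (local_rep A c X)"
  by (simp add: Ck_field_def)

lemma differential_eq:
  assumes "c \<in> A" "q \<in> fst c" "((f \<circ> chart_inv c) has_derivative f') (at (snd c q))"
  shows "differential A f q v = f' (components A c q v)"
  using frechet_derivative_at[OF change_chart_has_derivative[OF chart_at(1) assms(1) chart_at(2) assms(2,3)], symmetric]
  by (simp add: differential_def components_eq_trans)

lemma transition_C1:
  assumes "c \<in> A" "d \<in> A"
  shows "Ck_on 1 (snd c ` (fst c \<inter> fst d)) (\<lambda>y. snd d (chart_inv c y))"
  using transition_Ck[OF assms, of 1] by (simp only: o_def)

text \<open>Because transition maps are smooth, regularity has to be checked in one chart only.\<close>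

lemma C1_fun_from_chart:
  assumes "c \<in> A" "V \<subseteq> fst c" "open V"
    and "Ck_on 1 (snd c ` V) F" "\<And>q. q \<in> V \<Longrightarrow> f q = F (snd c q)"
  shows "Ck_fun A 1 V f"
  unfolding Ck_fun_def
proof
  fix d assume d: "d \<in> A"
  have "Ck_on 1 (snd d ` (fst d \<inter> V)) (\<lambda>y. F (snd c (chart_inv d y)))"
    by (rule C1_compose[OF assms(4) Ck_on_subset[OF transition_C1[OF d assms(1)]]])
       (use assms d in auto)
  then show "Ck_on 1 (snd d ` (fst d \<inter> V)) (f \<circ> chart_inv d)"
    by (subst Ck_on_cong[where h = "\<lambda>y. F (snd c (chart_inv d y))", OF open_chart_image[OF d assms(3)]])
       (use assms d in auto)
qed

text \<open>In another chart the components are multiplied by the Jacobian of the transition map, whose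
  entries have to be \<open>C\<^sup>1\<close>; so second derivatives of transition maps enter here.\<close>

lemma C1_field_from_chart:
  assumes "c \<in> A" "V \<subseteq> fst c" "open V"
    and "Ck_on 1 (snd c ` V) L" "\<And>q. q \<in> V \<Longrightarrow> X q = coord_field A c (L (snd c q)) q"
  shows "Ck_field A 1 V X"
  unfolding Ck_field_def
proof
  fix d assume d: "d \<in> A"
  let ?S = "snd d ` (fst d \<inter> V)" and ?\<tau> = "\<lambda>y. snd c (chart_inv d y)"
  have \<tau>: "Ck_on 1 ?S ?\<tau>"
    by (rule Ck_on_subset[OF transition_C1[OF d assms(1)]]) (use assms in auto)
  have V: "snd c ` V = snd c ` (fst c \<inter> V)"
    using assms(2) by (simp add: Int_absorb1)
  define h where "h y = (\<Sum>i\<in>UNIV. L (?\<tau> y) $ i *\<^sub>R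
      frechet_derivative (snd d \<circ> chart_inv c) (at (?\<tau> y)) (axis i 1))" for y
  have "Ck_on 1 ?S h"
    unfolding h_def
  proof (intro C1_sum C1_scaleR)
    fix i
    show "Ck_on 1 ?S (\<lambda>y. L (?\<tau> y) $ i)"
      by (intro C1_vec_nth C1_compose[OF assms(4) \<tau>]) (use d in auto)
    have "Ck_on 1 (snd c ` (fst c \<inter> fst d)) (\<lambda>z. frechet_derivative (snd d \<circ> chart_inv c) (at z) (axis i 1))"
      using transition_Ck[OF assms(1) d, of 2] by (simp add: numeral_2_eq_2)
    then show "Ck_on 1 ?S (\<lambda>y. frechet_derivative (snd d \<circ> chart_inv c) (at (?\<tau> y)) (axis i 1))"
      by (rule C1_compose[OF _ \<tau>]) (use assms(2) d in auto)
  qed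
  moreover have "local_rep A d X y = h y" if y: "y \<in> ?S" for y
  proof -
    define q where "q = chart_inv d y"
    have q: "q \<in> fst d" "q \<in> V" "q \<in> fst c"
      using y d assms(2) by (auto simp: q_def)
    interpret linear "trans c d q"
      using linear_trans assms(1) d q by blast
    have "local_rep A d X y = components A d q (coord_field A c (L (snd c q)) q)"
      using q assms(5) by (simp add: local_rep_def q_def)
    also have "\<dots> = trans c d q (L (snd c q))"
      using assms(1) d q by (simp add: components_eq_trans coord_field_eq_trans trans_trans)
    also have "\<dots> = trans c d q (\<Sum>i\<in>UNIV. L (snd c q) $ i *\<^sub>R axis i 1)"
      by (simp add: vec_expansion)
    also have "\<dots> = h y"
      by (simp only: sum scale h_def q_def[symmetric]) (simp add: trans_def)
    finally show ?thesis .
  qed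
  ultimately show "Ck_on 1 ?S (local_rep A d X)"
    using Ck_on_cong[OF open_chart_image[OF d assms(3)]] by metis
qed

end

section \<open>Tangent spaces of level sets\<close>

context manifold
begin

lemma defining_functionD:
  assumes "defining_function A S W f"
  shows "open W" "Ck_fun A 2 W f" "q \<in> W \<Longrightarrow> \<exists>v. differential A f q v \<noteq> 0"
    "q \<in> W \<Longrightarrow> q \<in> S \<longleftrightarrow> f q = 0"
  using assms by (auto simp: defining_function_def)

lemma Ck_fun_has_derivative:
  assumes "Ck_fun A (Suc k) W f" "c \<in> A" "y \<in> snd c ` (fst c \<inter> W)"
  shows "((f \<circ> chart_inv c) has_derivative frechet_derivative (f \<circ> chart_inv c) (at y)) (at y)"
  by (rule Ck_on_has_derivative[OF Ck_fun_chart[OF assms(1,2)] assms(3)])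

lemma differential_chart:
  assumes "Ck_fun A (Suc k) W f" "c \<in> A" "q \<in> fst c" "q \<in> W"
  shows "differential A f q v = frechet_derivative (f \<circ> chart_inv c) (at (snd c q)) (components A c q v)"
  by (rule differential_eq[OF assms(2,3) Ck_fun_has_derivative[OF assms(1,2)]]) (use assms in auto)

lemma differential_chart_coord:
  assumes "Ck_fun A (Suc k) W f" "c \<in> A" "y \<in> snd c ` (fst c \<inter> W)"
  shows "differential A f (chart_inv c y) (coord_field A c u (chart_inv c y)) =
    frechet_derivative (f \<circ> chart_inv c) (at y) u"
  using assms(2,3) differential_chart[OF assms(1,2)] by auto

lemma linear_differential:
  assumes "Ck_fun A (Suc k) W f" "q \<in> W"
  shows "linear (differential A f q)"
proof -
  let ?D = "frechet_derivative (f \<circ> chart_inv (chart_at A q)) (at (snd (chart_at A q) q))"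
  have "linear ?D"
    by (rule has_derivative_linear[OF Ck_fun_has_derivative[OF assms(1)]]) (use assms(2) in auto)
  moreover have "differential A f q = ?D"
    using differential_chart[OF assms(1) chart_at assms(2)] by auto
  ultimately show ?thesis
    by simp
qed

text \<open>Curves are read in the chart and shortened so that they stay in a prescribed neighbourhood.\<close>

lemma tangent_vector_curve:
  fixes p c defines "c \<equiv> chart_at A p"
  assumes "v \<in> tangent_space A S p" "open W" "p \<in> W"
  obtains \<kappa> e where "e > (0::real)" "\<kappa> 0 = snd c p" "(\<kappa> has_vector_derivative v) (at 0)"
    "\<And>t. \<bar>t\<bar> < e \<Longrightarrow> \<kappa> t \<in> snd c ` (fst c \<inter> W) \<and> chart_inv c (\<kappa> t) \<in> S"
proof -
  obtain \<gamma> e where \<gamma>: "e > 0" "\<gamma> 0 = p" "\<And>t. t \<in> {-e<..<e} \<Longrightarrow> \<gamma> t \<in> S \<inter> fst c"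
    "Ck_on 1 {-e<..<e} (snd c \<circ> \<gamma>)" "((snd c \<circ> \<gamma>) has_vector_derivative v) (at 0)"
    using assms(2) unfolding tangent_space_def c_def by blast
  have c: "c \<in> A" "p \<in> fst c"
    by (simp_all add: c_def)
  let ?U = "snd c ` (fst c \<inter> W)"
  have "open ({-e<..<e} \<inter> (snd c \<circ> \<gamma>) -` ?U)"
    by (intro continuous_open_preimage Ck_on_continuous[OF \<gamma>(4)] open_chart_image c assms) simp
  moreover have "0 \<in> {-e<..<e} \<inter> (snd c \<circ> \<gamma>) -` ?U"
    using \<gamma>(1,2) c assms(4) by simp
  ultimately obtain d where d: "d > 0" "ball 0 d \<subseteq> {-e<..<e} \<inter> (snd c \<circ> \<gamma>) -` ?U"
    using open_contains_ball by meson
  show thesis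
  proof (rule that[of d "snd c \<circ> \<gamma>"])
    fix t :: real assume "\<bar>t\<bar> < d"
    then have "t \<in> {-e<..<e} \<inter> (snd c \<circ> \<gamma>) -` ?U"
      using d(2) by (auto simp: subset_iff)
    then show "(snd c \<circ> \<gamma>) t \<in> ?U \<and> chart_inv c ((snd c \<circ> \<gamma>) t) \<in> S"
      using \<gamma>(3)[of t] c by auto
  qed (use d \<gamma> in auto)
qed

text \<open>One inclusion is the chain rule; the other needs curves inside the level set, which
  \<open>curve_in_zero_set\<close> provides.\<close>

lemma tangent_space_eq_kernel:
  assumes "defining_function A S W f" "p \<in> W" "p \<in> S"
  shows "tangent_space A S p = {v. differential A f p v = 0}"
proof -
  define c where "c = chart_at A p"
  define F where "F = f \<circ> chart_inv c"
  let ?U = "snd c ` (fst c \<inter> W)"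
  note df = defining_functionD[OF assms(1)]
  have c: "c \<in> A" "p \<in> fst c"
    by (simp_all add: c_def)
  have f1: "Ck_fun A (Suc 1) W f"
    using df(2) by (simp add: numeral_2_eq_2)
  have diff: "differential A f p v = frechet_derivative F (at (snd c p)) v" for v
    using differential_chart[OF f1 c assms(2)] by (simp add: F_def) (simp add: c_def)
  have F_der: "(F has_derivative frechet_derivative F (at y)) (at y)" if "y \<in> ?U" for y
    unfolding F_def by (rule Ck_fun_has_derivative[OF f1 c(1) that])
  have pU: "snd c p \<in> ?U"
    using c assms(2) by simp
  have "differential A f p v = 0" if v: "v \<in> tangent_space A S p" for v
  proof -
    obtain \<kappa> e where \<kappa>: "e > (0::real)" "\<kappa> 0 = snd c p" "(\<kappa> has_vector_derivative v) (at 0)"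
      "\<And>t. \<bar>t\<bar> < e \<Longrightarrow> \<kappa> t \<in> ?U \<and> chart_inv c (\<kappa> t) \<in> S"
      using tangent_vector_curve[OF v df(1) assms(2)] unfolding c_def by metis
    have "((\<lambda>t. F (\<kappa> t)) has_derivative (\<lambda>s. frechet_derivative F (at (snd c p)) (s *\<^sub>R v))) (at 0)"
      using has_derivative_compose[OF \<kappa>(3)[unfolded has_vector_derivative_def], of F] F_der[OF pU] \<kappa>(2)
      by simp
    moreover have "((\<lambda>t. F (\<kappa> t)) has_derivative (\<lambda>s. 0)) (at 0)"
    proof (rule has_derivative_transform_within_open)
      show "0 = F (\<kappa> t)" if "t \<in> {-e<..<e}" for t
        using \<kappa>(4)[of t] that df(4)[of "chart_inv c (\<kappa> t)"] in_chart_image[OF c(1), of "\<kappa> t" W]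
        by (simp add: F_def abs_less_iff)
    qed (use \<kappa>(1) in auto)
    ultimately have "(\<lambda>s. frechet_derivative F (at (snd c p)) (s *\<^sub>R v)) = (\<lambda>s. 0)"
      using has_derivative_unique by blast
    from fun_cong[OF this, of 1] show ?thesis
      by (simp add: diff)
  qed
  moreover have "v \<in> tangent_space A S p" if v: "differential A f p v = 0" for v
  proof -
    have F1: "Ck_on 1 ?U F"
      unfolding F_def by (rule Ck_on_2_imp_1[OF Ck_fun_chart[OF df(2) c(1)]])
    have "frechet_derivative F (at (snd c p)) \<noteq> (\<lambda>v. 0)"
      using df(3)[OF assms(2)] diff by auto
    moreover have "F (snd c p) = 0"
      using df(4)[OF assms(2)] assms(3) c by (simp add: F_def)
    ultimately obtain \<kappa> e where \<kappa>: "e > (0::real)" "\<kappa> 0 = snd c p"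
      "\<And>t. t \<in> {-e<..<e} \<Longrightarrow> \<kappa> t \<in> ?U \<and> F (\<kappa> t) = 0"
      "Ck_on 1 {-e<..<e} \<kappa>" "(\<kappa> has_vector_derivative v) (at 0)"
      using curve_in_zero_set[OF open_chart_image[OF c(1) df(1)] pU F1 _ _ v[unfolded diff]] by metis
    let ?\<gamma> = "chart_inv c \<circ> \<kappa>"
    have \<gamma>: "?\<gamma> t \<in> S \<inter> fst c" "(snd c \<circ> ?\<gamma>) t = \<kappa> t" if "t \<in> {-e<..<e}" for t
      using \<kappa>(3)[OF that] df(4) c(1) by (auto simp: F_def)
    have "Ck_on 1 {-e<..<e} (snd c \<circ> ?\<gamma>)"
      using Ck_on_cong[of "{-e<..<e}" "snd c \<circ> ?\<gamma>" \<kappa> 1] \<gamma>(2) \<kappa>(4)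
      by (simp del: Ck_on.simps One_nat_def comp_apply)
    moreover have "((snd c \<circ> ?\<gamma>) has_vector_derivative v) (at 0)"
      using has_vector_derivative_transform_within_open[OF \<kappa>(5), of "{-e<..<e}"] \<gamma>(2) \<kappa>(1) by simp
    ultimately show ?thesis
      unfolding tangent_space_def using \<kappa>(1,2) \<gamma>(1) c
      by (auto simp: c_def[symmetric] intro!: exI[of _ ?\<gamma>] exI[of _ e] simp del: Ck_on.simps One_nat_def)
  qed
  ultimately show ?thesis
    by blast
qed

lemma one_sidedD:
  assumes "one_sided_defining_function A D W f"
  shows "defining_function A (frontier D) W f" "q \<in> W \<Longrightarrow> q \<in> D \<longleftrightarrow> f q < 0"
  using assms by (auto simp: one_sided_defining_function_def)

text \<open>Moving from \<open>p\<close> a little in the direction \<open>- v\<close> makes \<open>f\<close> negative, so it leads into \<open>D\<close>, hence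
  into \<open>E\<close>, where \<open>h\<close> is negative.  For \<open>D = E\<close> this compares two defining functions of the same
  domain.\<close>

lemma one_sided_differential_mono:
  assumes "one_sided_defining_function A D W f" "one_sided_defining_function A E V h" "D \<subseteq> E"
    and "p \<in> W" "p \<in> V" "p \<in> frontier D" "p \<in> frontier E" "differential A f p v > 0"
  shows "differential A h p v \<ge> 0"
proof (rule ccontr)
  assume neg: "\<not> ?thesis"
  note df = defining_functionD[OF one_sidedD(1)[OF assms(1)]] one_sidedD(2)[OF assms(1)]
  note dh = defining_functionD[OF one_sidedD(1)[OF assms(2)]] one_sidedD(2)[OF assms(2)]
  define c where "c = chart_at A p"
  have c: "c \<in> A" "p \<in> fst c"
    by (simp_all add: c_def)
  define y where "y = snd c p"
  have der: "((\<lambda>t. (k \<circ> chart_inv c) (y + t *\<^sub>R v)) has_real_derivative differential A k p v) (at 0)"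
    if k: "Ck_fun A 2 Z k" "p \<in> Z" for k Z
  proof -
    have k2: "Ck_fun A (Suc 1) Z k"
      using k by (simp add: numeral_2_eq_2)
    let ?D = "frechet_derivative (k \<circ> chart_inv c) (at y)"
    have D: "((k \<circ> chart_inv c) has_derivative ?D) (at (y + 0 *\<^sub>R v))"
      using Ck_fun_has_derivative[OF k2 c(1), of y] k(2) c by (simp add: y_def)
    have "((\<lambda>t. y + t *\<^sub>R v) has_derivative (\<lambda>s. s *\<^sub>R v)) (at 0)"
      by (rule derivative_eq_intros refl | simp)+
    from has_derivative_compose[OF this D]
    have "((\<lambda>t. (k \<circ> chart_inv c) (y + t *\<^sub>R v)) has_derivative (\<lambda>s. ?D (s *\<^sub>R v))) (at 0)" .
    moreover have "?D (s *\<^sub>R v) = differential A k p v * s" for s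
      using differential_chart[OF k2 c k(2), of v] has_derivative_linear[OF D]
      by (simp add: c_def[symmetric] y_def linear_scale) (simp add: c_def)
    ultimately show ?thesis
      by (simp add: has_field_derivative_def fun_eq_iff[symmetric])
  qed
  have y0: "chart_inv c (y + 0 *\<^sub>R v) = p"
    using c by (simp add: y_def)
  obtain d1 where d1: "d1 > 0" "\<And>t. t > 0 \<Longrightarrow> t < d1 \<Longrightarrow> f (chart_inv c (y + (0 - t) *\<^sub>R v)) < f p"
    using DERIV_pos_inc_left[OF der[OF df(2) assms(4)] assms(8)] y0 by (metis comp_apply)
  obtain d2 where d2: "d2 > 0" "\<And>t. t > 0 \<Longrightarrow> t < d2 \<Longrightarrow> h (chart_inv c (y + (0 - t) *\<^sub>R v)) > h p"
    using DERIV_neg_dec_left[OF der[OF dh(2) assms(5)]] neg y0 by (metis comp_apply not_le)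
  let ?U = "snd c ` (fst c \<inter> (W \<inter> V))"
  have "open ((\<lambda>t::real. y + t *\<^sub>R v) -` ?U)"
    by (intro open_vimage open_chart_image c open_Int df(1) dh(1) continuous_intros)
  moreover have "0 \<in> (\<lambda>t::real. y + t *\<^sub>R v) -` ?U"
    using c assms by (simp add: y_def)
  ultimately obtain d3 where d3: "d3 > 0" "ball 0 d3 \<subseteq> (\<lambda>t::real. y + t *\<^sub>R v) -` ?U"
    using open_contains_ball by meson
  define t where "t = min d1 (min d2 d3) / 2"
  have t: "t > 0" "t < d1" "t < d2" "t < d3"
    using d1(1) d2(1) d3(1) by (auto simp: t_def min_def)
  define q where "q = chart_inv c (y + (0 - t) *\<^sub>R v)"
  have "0 - t \<in> ball 0 d3"
    using t by simp
  then have "y + (0 - t) *\<^sub>R v \<in> ?U"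
    using d3(2) by blast
  then have q: "q \<in> W" "q \<in> V"
    using in_chart_image[OF c(1)] unfolding q_def by blast+
  have "f q < 0" "h q > 0"
    using d1(2)[OF t(1,2)] d2(2)[OF t(1,3)] df(4)[OF assms(4)] dh(4)[OF assms(5)] assms(6,7)
    by (auto simp: q_def)
  then show False
    using df(5)[OF q(1)] dh(5)[OF q(2)] assms(3) by auto
qed

end

section \<open>Unit normals\<close>

locale riemannian_manifold = manifold A
  for A :: "('a::{t2_space, second_countable_topology}, 'n::finite) chart set" +
  fixes g :: "'a \<Rightarrow> real ^ 'n \<Rightarrow> real ^ 'n \<Rightarrow> real"
  assumes metric: "riemannian_metric A g"
begin

lemma metric_bilinear: "bilinear (g p)"
  and metric_sym: "g p u v = g p v u"
  and metric_pos: "v \<noteq> 0 \<Longrightarrow> g p v v > 0"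
  using metric by (auto simp: riemannian_metric_def)

abbreviation metric_coord :: "('a, 'n) chart \<Rightarrow> real ^ 'n \<Rightarrow> real ^ 'n \<Rightarrow> real ^ 'n \<Rightarrow> real" where
  "metric_coord c y u v \<equiv> g (chart_inv c y) (coord_field A c u (chart_inv c y)) (coord_field A c v (chart_inv c y))"

lemma metric_coord_Ck: "c \<in> A \<Longrightarrow> Ck_on k (snd c ` fst c) (\<lambda>y. metric_coord c y u v)"
  using metric by (simp add: riemannian_metric_def o_def)

lemma metric_coord_bilinear:
  assumes "c \<in> A" "y \<in> snd c ` fst c"
  shows "bilinear (metric_coord c y)"
proof -
  interpret l: linear "\<lambda>u. coord_field A c u (chart_inv c y)"
    by (rule linear_coord_field) (use assms in auto)
  show ?thesis
    using metric_bilinear[of "chart_inv c y"]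
    by (auto simp: bilinear_def linear_iff l.add l.scale)
qed

lemma metric_coord_pos:
  assumes "c \<in> A" "y \<in> snd c ` fst c" "v \<noteq> 0"
  shows "metric_coord c y v v > 0"
proof -
  have q: "chart_inv c y \<in> fst c"
    using assms by auto
  have "coord_field A c v (chart_inv c y) \<noteq> 0"
    using components_coord_field(1)[OF assms(1) q, of v] assms(3)
      linear_0[OF linear_components[OF assms(1) q]] by metis
  then show ?thesis
    by (rule metric_pos)
qed

lemma metric_coord_expand:
  assumes "c \<in> A" "y \<in> snd c ` fst c"
  shows "metric_coord c y z v = (\<Sum>i\<in>UNIV. z $ i * metric_coord c y (axis i 1) v)"
proof -
  interpret linear "\<lambda>z. metric_coord c y z v"
    using metric_coord_bilinear[OF assms] by (simp add: bilinear_def)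
  show ?thesis
    by (subst (1) vec_expansion[of z, symmetric], subst sum) (simp add: scale)
qed

text \<open>The normalised gradient of \<open>f\<close>.  Its components in a chart solve a linear system whose matrix
  is that of the metric.\<close>

lemma unit_normal_field:
  assumes def: "defining_function A S W f" and c: "c \<in> A"
  obtains N where "Ck_field A 1 (fst c \<inter> W) N"
    "\<And>q. q \<in> fst c \<inter> W \<Longrightarrow> g q (N q) (N q) = 1"
    "\<And>q. q \<in> fst c \<inter> W \<Longrightarrow> \<exists>\<mu>>0. \<forall>v. g q (N q) v = \<mu> * differential A f q v"
proof -
  note df = defining_functionD[OF def]
  have f1: "Ck_fun A (Suc 1) W f"
    using df(2) by (simp add: numeral_2_eq_2)
  let ?V = "fst c \<inter> W"
  let ?U = "snd c ` ?V"
  define D where "D y = frechet_derivative (f \<circ> chart_inv c) (at y)" for y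
  have y_chart: "y \<in> snd c ` fst c" if "y \<in> ?U" for y
    using that by auto
  have D_lin: "linear (D y)" if "y \<in> ?U" for y
    unfolding D_def by (rule has_derivative_linear[OF Ck_fun_has_derivative[OF f1 c that]])
  have D_C1: "Ck_on 1 ?U (\<lambda>y. D y u)" for u
    unfolding D_def using Ck_fun_chart[OF f1 c] by simp
  define M :: "real ^ 'n \<Rightarrow> real ^ 'n ^ 'n"
    where "M y = (\<chi> i j. metric_coord c y (axis i 1) (axis j 1))" for y
  define w where "w y = (\<chi> i. D y (axis i 1))" for y
  have M: "(M y *v z) \<bullet> v = metric_coord c y z v" if y: "y \<in> ?U" for y z v
  proof -
    have "(M y *v z) $ i = metric_coord c y z (axis i 1)" for i
      by (subst metric_coord_expand[OF c y_chart[OF y]])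
         (simp add: M_def matrix_vector_mult_def metric_sym mult.commute)
    then show ?thesis
      by (subst metric_sym, subst metric_coord_expand[OF c y_chart[OF y]])
         (simp add: inner_vec_def metric_sym mult.commute)
  qed
  have w: "w y \<bullet> v = D y v" if y: "y \<in> ?U" for y v
  proof -
    interpret linear "D y"
      by (rule D_lin[OF y])
    show ?thesis
      by (subst (2) vec_expansion[of v, symmetric], subst sum)
         (simp add: scale w_def inner_vec_def mult.commute)
  qed
  have det: "det (M y) \<noteq> 0" if y: "y \<in> ?U" for y
  proof -
    have "z = 0" if "M y *v z = 0" for z
      using M[OF y, of z z] metric_coord_pos[OF c y_chart[OF y], of z] that by fastforce
    then show ?thesis
      by (metis invertible_det_nz invertible_left_inverse matrix_left_invertible_ker)
  qed
  obtain z where z: "Ck_on 1 ?U z" "\<And>y. y \<in> ?U \<Longrightarrow> M y *v z y = w y"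
  proof (rule C1_linear_system)
    show "Ck_on 1 ?U (\<lambda>y. M y $ i $ j)" for i j
      unfolding M_def vec_lambda_beta using metric_coord_Ck[OF c] by (rule Ck_on_subset) auto
    show "Ck_on 1 ?U (\<lambda>y. w y $ i)" for i
      unfolding w_def vec_lambda_beta by (rule D_C1)
  qed (use det in auto)
  have z_grad: "metric_coord c y (z y) v = D y v" if "y \<in> ?U" for y v
    using M[OF that, of "z y" v] z(2)[OF that] w[OF that] by simp
  define \<rho> where "\<rho> y = z y \<bullet> w y" for y
  have \<rho>: "\<rho> y = metric_coord c y (z y) (z y)" "\<rho> y > 0" if y: "y \<in> ?U" for y
  proof -
    show 1: "\<rho> y = metric_coord c y (z y) (z y)"
      using z_grad[OF y, of "z y"] w[OF y, of "z y"] by (simp add: \<rho>_def inner_commute)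
    obtain v where "differential A f (chart_inv c y) v \<noteq> 0"
      using df(3)[of "chart_inv c y"] y c by auto
    then have "D y (components A c (chart_inv c y) v) \<noteq> 0"
      using differential_chart[OF f1 c, of "chart_inv c y" v] y c by (auto simp: D_def)
    then have "z y \<noteq> 0"
      using z_grad[OF y] linear_0[OF D_lin[OF y]]
        bilinear_lzero[OF metric_coord_bilinear[OF c y_chart[OF y]]] by metis
    then show "\<rho> y > 0"
      unfolding 1 using metric_coord_pos[OF c y_chart[OF y]] by blast
  qed
  define L where "L y = inverse (sqrt (\<rho> y)) *\<^sub>R z y" for y
  define N where "N q = coord_field A c (L (snd c q)) q" for q
  have "Ck_on 1 ?U \<rho>"
    unfolding \<rho>_def w_def inner_vec_def vec_lambda_beta inner_real_def
    by (intro C1_sum C1_mult C1_vec_nth z D_C1)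
  moreover have "sqrt (\<rho> y) \<noteq> 0" if "y \<in> ?U" for y
    using \<rho>(2)[OF that] by simp
  ultimately have "Ck_on 1 ?U L"
    unfolding L_def using \<rho>(2) by (intro C1_scaleR C1_inverse C1_sqrt z)
  then have "Ck_field A 1 ?V N"
    by (intro C1_field_from_chart[OF c, of _ L]) (use df(1) chart_homeomorphism(1)[OF c] N_def in auto)
  moreover have N: "g q (N q) v = inverse (sqrt (\<rho> (snd c q))) * differential A f q v"
    if q: "q \<in> ?V" for q v
  proof -
    let ?y = "snd c q" and ?u = "components A c q v"
    have y: "?y \<in> ?U"
      using q by simp
    have "g q (N q) v = metric_coord c ?y (L ?y) ?u"
      using q c by (simp add: N_def)
    also have "\<dots> = inverse (sqrt (\<rho> ?y)) * metric_coord c ?y (z ?y) ?u"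
      using bilinear_lmul[OF metric_coord_bilinear[OF c y_chart[OF y]]] by (simp add: L_def)
    finally show ?thesis
      using z_grad[OF y] differential_chart[OF f1 c, of q v] q by (simp add: D_def)
  qed
  moreover have "g q (N q) (N q) = 1" if q: "q \<in> ?V" for q
  proof -
    let ?y = "snd c q"
    have y: "?y \<in> ?U"
      using q by simp
    have b: "bilinear (metric_coord c ?y)"
      by (rule metric_coord_bilinear[OF c y_chart[OF y]])
    have "g q (N q) (N q) = metric_coord c ?y (L ?y) (L ?y)"
      using q c by (simp add: N_def)
    also have "\<dots> = inverse (sqrt (\<rho> ?y)) * (inverse (sqrt (\<rho> ?y)) * \<rho> ?y)"
      by (simp only: L_def bilinear_lmul[OF b] bilinear_rmul[OF b] \<rho>(1)[OF y] real_scaleR_def)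
    finally show ?thesis
      using \<rho>(2)[OF y] by (simp add: field_simps)
  qed
  moreover have "\<exists>\<mu>>0. \<forall>v. g q (N q) v = \<mu> * differential A f q v" if q: "q \<in> ?V" for q
    using N[OF q] \<rho>(2)[of "snd c q"] q by (intro exI[of _ "inverse (sqrt (\<rho> (snd c q)))"]) auto
  ultimately show thesis
    using that by blast
qed

text \<open>A unit vector is the outward normal as soon as it represents a positive multiple of the
  differential of some one-sided defining function.  Uniqueness up to sign comes from the tangent
  space being the kernel of the differential; the sign does not depend on the defining function.\<close>

lemma outward_unit_normal_eq:
  assumes f: "one_sided_defining_function A D W f" and p: "p \<in> W" "p \<in> frontier D"
    and \<nu>: "g p \<nu> \<nu> = 1" "\<mu> > 0" "\<And>v. g p \<nu> v = \<mu> * differential A f p v"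
  shows "outward_unit_normal A g D p = \<nu>"
  unfolding outward_unit_normal_def
proof (rule the_equality)
  note df = defining_functionD[OF one_sidedD(1)[OF f]]
  have f1: "Ck_fun A (Suc 1) W f"
    using df(2) by (simp add: numeral_2_eq_2)
  have T: "tangent_space A (frontier D) p = {v. differential A f p v = 0}"
    by (rule tangent_space_eq_kernel[OF one_sidedD(1)[OF f] p])
  interpret d: linear "differential A f p"
    by (rule linear_differential[OF f1 p(1)])
  have d\<nu>: "differential A f p \<nu> > 0"
    using \<nu>(1,2) \<nu>(3)[of \<nu>] by (metis zero_less_mult_pos zero_less_one)
  show "g p \<nu> \<nu> = 1 \<and> (\<forall>v\<in>tangent_space A (frontier D) p. g p \<nu> v = 0) \<and> outward_pointing A D p \<nu>"
    using \<nu> T f p d\<nu> by (auto simp: outward_pointing_def)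
  fix \<nu>' assume *: "g p \<nu>' \<nu>' = 1 \<and> (\<forall>v\<in>tangent_space A (frontier D) p. g p \<nu>' v = 0) \<and> outward_pointing A D p \<nu>'"
  define s where "s = g p \<nu>' \<nu>"
  have "g p (\<nu>' - s *\<^sub>R \<nu>) v = 0" for v
  proof -
    let ?k = "differential A f p v / differential A f p \<nu>"
    have "v - ?k *\<^sub>R \<nu> \<in> tangent_space A (frontier D) p"
      using d\<nu> by (simp add: T d.diff d.scale)
    then have "g p \<nu>' (v - ?k *\<^sub>R \<nu>) = 0" "g p \<nu> (v - ?k *\<^sub>R \<nu>) = 0"
      using * \<nu>(3) T by auto
    then show ?thesis
      using metric_bilinear[of p] \<nu>(1)
      by (simp add: bilinear_rsub bilinear_rmul bilinear_lsub bilinear_lmul s_def)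
  qed
  then have \<nu>': "\<nu>' = s *\<^sub>R \<nu>"
    using metric_pos[of "\<nu>' - s *\<^sub>R \<nu>" p] by (metis eq_iff_diff_eq_0 less_irrefl)
  obtain V h where h: "p \<in> V" "one_sided_defining_function A D V h" "differential A h p \<nu>' > 0"
    using * by (auto simp: outward_pointing_def)
  have "differential A f p \<nu>' \<ge> 0"
    by (rule one_sided_differential_mono[OF h(2) f order_refl h(1) p(1,2,2) h(3)])
  then have "s \<ge> 0"
    using d\<nu> by (simp add: \<nu>' d.scale zero_le_mult_iff)
  moreover have "s * s = 1"
    using * \<nu>(1) metric_bilinear[of p] by (simp add: \<nu>' bilinear_rmul bilinear_lmul)
  ultimately have "s = 1"
    by (metis abs_of_nonneg abs_square_eq_1 power2_eq_square)
  then show "\<nu>' = \<nu>"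
    by (simp add: \<nu>')
qed

lemma outward_unit_normal:
  assumes f: "one_sided_defining_function A D W f" and q: "q \<in> W" "q \<in> frontier D"
  shows "g q (outward_unit_normal A g D q) (outward_unit_normal A g D q) = 1"
    and "\<exists>\<mu>>0. \<forall>v. g q (outward_unit_normal A g D q) v = \<mu> * differential A f q v"
proof -
  obtain N where N: "\<And>p. p \<in> fst (chart_at A q) \<inter> W \<Longrightarrow> g p (N p) (N p) = 1"
    "\<And>p. p \<in> fst (chart_at A q) \<inter> W \<Longrightarrow> \<exists>\<mu>>0. \<forall>v. g p (N p) v = \<mu> * differential A f p v"
    using unit_normal_field[OF one_sidedD(1)[OF f] chart_at(1)] by metis
  have q': "q \<in> fst (chart_at A q) \<inter> W"
    using q by simp
  have "outward_unit_normal A g D q = N q"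
    using N[OF q'] outward_unit_normal_eq[OF f q] by metis
  then show "g q (outward_unit_normal A g D q) (outward_unit_normal A g D q) = 1"
    "\<exists>\<mu>>0. \<forall>v. g q (outward_unit_normal A g D q) v = \<mu> * differential A f q v"
    using N[OF q'] by auto
qed

text \<open>The normalised gradient of a defining function witnesses that the choice in the definition of
  \<open>normal_extension\<close> succeeds.\<close>

lemma normal_extension:
  assumes "one_sided_defining_function A D W f" "p \<in> W"
  obtains V where "open V" "p \<in> V" "Ck_field A 1 V (normal_extension A g D p)"
    "\<And>q. q \<in> V \<Longrightarrow> q \<in> frontier D \<Longrightarrow> normal_extension A g D p q = outward_unit_normal A g D q"
proof -
  let ?V = "fst (chart_at A p) \<inter> W"
  obtain N where N: "Ck_field A 1 ?V N" "\<And>q. q \<in> ?V \<Longrightarrow> g q (N q) (N q) = 1"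
    "\<And>q. q \<in> ?V \<Longrightarrow> \<exists>\<mu>>0. \<forall>v. g q (N q) v = \<mu> * differential A f q v"
    using unit_normal_field[OF one_sidedD(1)[OF assms(1)] chart_at(1)] by metis
  have "N q = outward_unit_normal A g D q" if "q \<in> ?V \<inter> frontier D" for q
    using N(2,3)[of q] outward_unit_normal_eq[OF assms(1), of q "N q"] that by auto
  moreover have "open ?V"
    by (intro open_Int chart_homeomorphism(1) chart_at defining_functionD(1)[OF one_sidedD(1)[OF assms(1)]])
  ultimately have "\<exists>N V. open V \<and> p \<in> V \<and> Ck_field A 1 V N \<and>
      (\<forall>q\<in>V \<inter> frontier D. N q = outward_unit_normal A g D q)"
    using N(1) assms(2) chart_at(2) by blast
  from someI_ex[OF this] show thesis
    unfolding normal_extension_def[symmetric] using that by blast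
qed

end

section \<open>Covariant derivatives in a chart\<close>

context manifold
begin

text \<open>The usual formula with Christoffel symbols, here the terms \<open>nabla p v (coord_field A c (axis i 1))\<close>.
  Multiplying by the indicator of a neighbourhood of \<open>p\<close> turns the local frame expansion of \<open>X\<close>
  into an identity of globally defined functions, to which the axioms of a connection apply.\<close>

lemma nabla_in_chart:
  fixes p c defines "c \<equiv> chart_at A p"
  assumes nabla: "affine_connection A nabla" and W: "open W" "p \<in> W" and X: "Ck_field A 1 W X"
  shows "nabla p v X = frechet_derivative (local_rep A c X) (at (snd c p)) v +
    (\<Sum>i\<in>UNIV. X p $ i *\<^sub>R nabla p v (coord_field A c (axis i 1)))"
proof -
  have c: "c \<in> A" "p \<in> fst c"
    by (simp_all add: c_def)
  define V where "V = fst c \<inter> W"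
  have V: "open V" "p \<in> V" "V \<subseteq> fst c"
    using W c chart_homeomorphism(1)[OF c(1)] by (auto simp: V_def)
  define L where "L = local_rep A c X"
  have L: "Ck_on 1 (snd c ` V) L"
    unfolding L_def V_def by (rule Ck_field_chart[OF X c(1)])
  have Lp: "L (snd c p) = X p"
    using c by (simp add: L_def local_rep_def) (simp add: c_def)
  define E where "E i = coord_field A c (axis i 1)" for i
  define \<phi> where "\<phi> i q = (if q \<in> V then L (snd c q) $ i else 0)" for i q
  define ind :: "'a \<Rightarrow> real" where "ind q = (if q \<in> V then 1 else 0)" for q
  have near_fun: "C1_fun_near A p k" if "Ck_fun A 1 V k" for k
    using that V unfolding C1_fun_near_def by blast
  have near_field: "C1_field_near A p Y" if "Ck_field A 1 V Y" for Y
    using that V unfolding C1_field_near_def by blast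
  have \<phi>_C1: "C1_fun_near A p (\<phi> i)" for i
    by (intro near_fun C1_fun_from_chart[OF c(1) V(3,1) C1_vec_nth[OF L]]) (simp add: \<phi>_def)
  have ind_C1: "C1_fun_near A p ind"
    by (intro near_fun C1_fun_from_chart[OF c(1) V(3,1) C1_const]) (simp add: ind_def)
  have E_C1: "C1_field_near A p (E i)" for i
    by (intro near_field C1_field_from_chart[OF c(1) V(3,1) C1_const]) (simp add: E_def)
  have sum_C1: "C1_field_near A p (\<lambda>q. \<Sum>i\<in>I. \<phi> i q *\<^sub>R E i q)" for I
  proof (intro near_field C1_field_from_chart[OF c(1) V(3,1)])
    show "Ck_on 1 (snd c ` V) (\<lambda>y. \<Sum>i\<in>I. L y $ i *\<^sub>R axis i 1)"
      by (intro C1_sum C1_scaleR C1_vec_nth C1_const L)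
    show "(\<Sum>i\<in>I. \<phi> i q *\<^sub>R E i q) = coord_field A c (\<Sum>i\<in>I. L (snd c q) $ i *\<^sub>R axis i 1) q"
      if "q \<in> V" for q
    proof -
      interpret linear "\<lambda>u. coord_field A c u q"
        using linear_coord_field c(1) that V(3) by blast
      show ?thesis
        using that by (simp add: sum scale \<phi>_def E_def)
    qed
  qed
  have \<phi>_diff: "differential A (\<phi> i) p v = frechet_derivative L (at (snd c p)) v $ i" for i
  proof -
    have "((\<lambda>y. L y $ i) has_derivative (\<lambda>v. frechet_derivative L (at (snd c p)) v $ i)) (at (snd c p))"
      by (rule bounded_linear.has_derivative[OF bounded_linear_vec_nth C1_onD(1)[OF L]]) (use V in blast)
    then have "((\<phi> i \<circ> chart_inv c) has_derivative
        (\<lambda>v. frechet_derivative L (at (snd c p)) v $ i)) (at (snd c p))"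
      by (rule has_derivative_transform_within_open[of _ _ _ _ "snd c ` V"])
         (use V c open_chart_image[OF c(1) W(1)] in \<open>auto simp: \<phi>_def V_def\<close>)
    then show ?thesis
      using differential_eq[OF c, of "\<phi> i"] by (simp add: c_def)
  qed
  have ind_diff: "differential A ind p v = 0"
  proof -
    have "((ind \<circ> chart_inv c) has_derivative (\<lambda>v. 0)) (at (snd c p))"
      by (rule has_derivative_transform_within_open[OF has_derivative_const[of 1], of "snd c ` V"])
         (use V c open_chart_image[OF c(1) W(1)] in \<open>auto simp: ind_def V_def\<close>)
    then show ?thesis
      using differential_eq[OF c] by simp
  qed
  have add: "nabla p v (\<lambda>q. Y q + Z q) = nabla p v Y + nabla p v Z"
    if "C1_field_near A p Y" "C1_field_near A p Z" for Y Z
    by (rule nabla[unfolded affine_connection_def, THEN conjunct2, THEN conjunct1, rule_format, OF that])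
  have leibniz: "nabla p v (\<lambda>q. k q *\<^sub>R Y q) = differential A k p v *\<^sub>R Y p + k p *\<^sub>R nabla p v Y"
    if "C1_fun_near A p k" "C1_field_near A p Y" for k Y
    by (rule nabla[unfolded affine_connection_def, THEN conjunct2, THEN conjunct2, THEN conjunct1,
          rule_format, OF that])
  have zero: "nabla p v (\<lambda>q. 0) = 0"
    using add[OF sum_C1[of "{}"] sum_C1[of "{}"]] by simp
  have "nabla p v (\<lambda>q. \<Sum>i\<in>I. \<phi> i q *\<^sub>R E i q) =
      (\<Sum>i\<in>I. differential A (\<phi> i) p v *\<^sub>R E i p + \<phi> i p *\<^sub>R nabla p v (E i))" if "finite I" for I
    using that
  proof (induction I)
    case (insert j I)
    have "C1_field_near A p (\<lambda>q. \<phi> j q *\<^sub>R E j q)"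
      using sum_C1[of "{j}"] by simp
    then show ?case
      using insert add[OF _ sum_C1[of I]] leibniz[OF \<phi>_C1 E_C1] by simp
  qed (simp add: zero)
  then have "nabla p v (\<lambda>q. \<Sum>i\<in>UNIV. \<phi> i q *\<^sub>R E i q) =
      (\<Sum>i\<in>UNIV. frechet_derivative L (at (snd c p)) v $ i *\<^sub>R axis i 1) +
      (\<Sum>i\<in>UNIV. X p $ i *\<^sub>R nabla p v (E i))"
    using V(2) Lp \<phi>_diff by (simp add: sum.distrib E_def \<phi>_def) (simp add: c_def)
  moreover have "(\<lambda>q. \<Sum>i\<in>UNIV. \<phi> i q *\<^sub>R E i q) = (\<lambda>q. ind q *\<^sub>R X q)"
  proof
    fix q
    show "(\<Sum>i\<in>UNIV. \<phi> i q *\<^sub>R E i q) = ind q *\<^sub>R X q"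
    proof (cases "q \<in> V")
      case True
      then have q: "q \<in> fst c"
        using V(3) by blast
      interpret linear "\<lambda>u. coord_field A c u q"
        by (rule linear_coord_field[OF c(1) q])
      have "(\<Sum>i\<in>UNIV. \<phi> i q *\<^sub>R E i q) = coord_field A c (\<Sum>i\<in>UNIV. L (snd c q) $ i *\<^sub>R axis i 1) q"
        using True by (simp add: sum scale \<phi>_def E_def)
      also have "\<dots> = X q"
        using c(1) q by (simp add: vec_expansion L_def local_rep_def)
      finally show ?thesis
        using True by (simp add: ind_def)
    qed (simp add: \<phi>_def ind_def)
  qed
  moreover have "nabla p v (\<lambda>q. ind q *\<^sub>R X q) = nabla p v X"
    using leibniz[OF ind_C1, of X] X W V(2) ind_diff by (auto simp: C1_field_near_def ind_def)
  ultimately show ?thesis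
    by (simp add: vec_expansion L_def E_def)
qed

end

section \<open>The second fundamental form and the Hessian of a defining function\<close>

context riemannian_manifold
begin

text \<open>Along a curve in the boundary with velocity \<open>X\<close>, the covector \<open>g(N, _)\<close> is a multiple of
  \<open>df\<close>.  The multiple is eliminated by testing the covectors against \<open>X\<close> and \<open>\<nu>\<close>:
  \<open>g(N, X) df(\<nu>) = g(N, \<nu>) df(X)\<close>, where \<open>X\<close> and \<open>\<nu>\<close> are extended with constant components in the
  chart.  Both \<open>g(N, X)\<close> and \<open>df(X)\<close> vanish at \<open>p\<close>, so differentiating
  this identity there only involves the derivatives of these two factors.\<close>

lemma normal_derivative_hessian:
  fixes D p c \<nu> y
  defines "c \<equiv> chart_at A p" and "\<nu> \<equiv> outward_unit_normal A g D p" and "y \<equiv> snd (chart_at A p) p"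
  assumes f: "one_sided_defining_function A D W f" and p: "p \<in> W" "p \<in> frontier D"
    and V: "open V" "p \<in> V" "Ck_field A 1 V N"
      "\<And>q. q \<in> V \<Longrightarrow> q \<in> frontier D \<Longrightarrow> N q = outward_unit_normal A g D q"
    and X: "X \<in> tangent_space A (frontier D) p"
  shows "(g p (frechet_derivative (local_rep A c N) (at y) X) X +
      (\<Sum>i\<in>UNIV. \<nu> $ i * frechet_derivative (\<lambda>z. metric_coord c z (axis i 1) X) (at y) X)) *
      differential A f p \<nu> =
    frechet_derivative (\<lambda>z. frechet_derivative (f \<circ> chart_inv c) (at z) X) (at y) X"
proof -
  note df = defining_functionD[OF one_sidedD(1)[OF f]]
  have f1: "Ck_fun A (Suc 1) W f"
    using df(2) by (simp add: numeral_2_eq_2)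
  have c: "c \<in> A" "p \<in> fst c" and y: "y = snd c p"
    by (simp_all add: c_def y_def)
  have y_chart: "y \<in> snd c ` fst c" and y_inv: "chart_inv c y = p"
    using c by (simp_all add: y)
  define L where "L = local_rep A c N"
  define DF where "DF z = frechet_derivative (f \<circ> chart_inv c) (at z)" for z
  obtain e \<kappa> where \<kappa>: "e > (0::real)" "\<kappa> 0 = y" "(\<kappa> has_vector_derivative X) (at 0)"
    "\<And>t. \<bar>t\<bar> < e \<Longrightarrow> \<kappa> t \<in> snd c ` (fst c \<inter> (V \<inter> W)) \<and> chart_inv c (\<kappa> t) \<in> frontier D"
    by (rule tangent_vector_curve[OF X open_Int[OF V(1) df(1)] IntI[OF V(2) p(1)], folded c_def, folded y]) (rule that; simp)
  define P where "P u z = metric_coord c z (L z) u" for u z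
  have proportional: "P X (\<kappa> t) * DF (\<kappa> t) \<nu> = P \<nu> (\<kappa> t) * DF (\<kappa> t) X" if t: "\<bar>t\<bar> < e" for t
  proof -
    define q where "q = chart_inv c (\<kappa> t)"
    have \<kappa>t: "\<kappa> t \<in> snd c ` (fst c \<inter> W)" and q: "q \<in> fst c" "q \<in> V" "q \<in> W" "q \<in> frontier D"
      using \<kappa>(4)[OF t] in_chart_image[OF c(1)] c(1) by (auto simp: q_def)
    obtain \<mu> where \<mu>: "\<And>v. g q (N q) v = \<mu> * differential A f q v"
      using outward_unit_normal(2)[OF f q(3,4)] V(4)[OF q(2,4)] by auto
    have "P u (\<kappa> t) = \<mu> * DF (\<kappa> t) u" for u
    proof -
      have "P u (\<kappa> t) = g q (N q) (coord_field A c u q)"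
        using c(1) q(1) by (simp add: P_def L_def local_rep_def q_def[symmetric])
      then show ?thesis
        using \<mu> differential_chart_coord[OF f1 c(1) \<kappa>t] by (simp add: DF_def q_def)
    qed
    then show ?thesis
      by simp
  qed
  have Ly: "L y = \<nu>"
    using V(4)[OF V(2) p(2)] by (simp add: L_def local_rep_def y_inv) (simp add: c_def \<nu>_def)
  have metric_y: "metric_coord c y u v = g p u v" for u v
    by (simp add: y_inv) (simp add: c_def)
  have DF_y: "DF y v = differential A f p v" for v
    using differential_chart[OF f1 c p(1), of v] by (simp add: DF_def y) (simp add: c_def)
  obtain \<mu> where \<mu>: "\<mu> > 0" "\<And>v. g p \<nu> v = \<mu> * differential A f p v"
    using outward_unit_normal(2)[OF f p] by (auto simp: \<nu>_def)
  have DFX: "DF y X = 0"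
    using X tangent_space_eq_kernel[OF one_sidedD(1)[OF f] p] DF_y by simp
  have PX: "P X y = 0"
    using \<mu>(2) DFX DF_y by (simp add: P_def Ly metric_y)
  have P\<nu>: "P \<nu> y = 1"
    using outward_unit_normal(1)[OF f p] by (simp add: P_def Ly metric_y) (simp add: \<nu>_def)
  define L' where "L' = frechet_derivative L (at y)"
  define G' where "G' u i = frechet_derivative (\<lambda>z. metric_coord c z (axis i 1) u) (at y)" for u i
  define P' where "P' u k = (\<Sum>i\<in>UNIV. L y $ i * G' u i k + L' k $ i * metric_coord c y (axis i 1) u)" for u k
  have P_der: "(P u has_derivative P' u) (at y)" for u
  proof (rule has_derivative_transform_within_open)
    have "(L has_derivative L') (at y)"
      unfolding L_def L'_def by (rule C1_onD(1)[OF Ck_field_chart[OF V(3) c(1)]]) (use c y V(2) in simp)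
    moreover have "((\<lambda>z. metric_coord c z (axis i 1) u) has_derivative G' u i) (at y)" for i
      unfolding G'_def by (rule C1_onD(1)[OF metric_coord_Ck[OF c(1)] y_chart])
    ultimately show "((\<lambda>z. \<Sum>i\<in>UNIV. L z $ i * metric_coord c z (axis i 1) u) has_derivative P' u) (at y)"
      unfolding P'_def
      by (intro has_derivative_sum has_derivative_mult bounded_linear.has_derivative[OF bounded_linear_vec_nth])
    show "(\<Sum>i\<in>UNIV. L z $ i * metric_coord c z (axis i 1) u) = P u z" if "z \<in> snd c ` fst c" for z
      unfolding P_def by (rule metric_coord_expand[OF c(1) that, symmetric])
  qed (rule chart_homeomorphism(2)[OF c(1)] y_chart)+
  define F'' where "F'' v = frechet_derivative (\<lambda>z. DF z v) (at y)" for v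
  have DF_der: "((\<lambda>z. DF z v) has_derivative F'' v) (at y)" for v
    unfolding F''_def
  proof (rule C1_onD(1))
    show "Ck_on 1 (snd c ` (fst c \<inter> W)) (\<lambda>z. DF z v)"
      unfolding DF_def using Ck_fun_chart[OF f1 c(1)] by simp
  qed (use c y p(1) in simp)
  have along: "((\<lambda>t. h (\<kappa> t)) has_derivative (\<lambda>s. h' (s *\<^sub>R X))) (at 0)"
    if "(h has_derivative h') (at y)" for h :: "real ^ 'n \<Rightarrow> real" and h'
    using has_derivative_compose[OF \<kappa>(3)[unfolded has_vector_derivative_def], of h h'] that \<kappa>(2) by simp
  have "((\<lambda>t. P X (\<kappa> t) * DF (\<kappa> t) \<nu>) has_derivative
      (\<lambda>s. P X (\<kappa> 0) * F'' \<nu> (s *\<^sub>R X) + P' X (s *\<^sub>R X) * DF (\<kappa> 0) \<nu>)) (at 0)"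
    by (intro has_derivative_mult along P_der DF_der)
  moreover have "((\<lambda>t. P X (\<kappa> t) * DF (\<kappa> t) \<nu>) has_derivative
      (\<lambda>s. P \<nu> (\<kappa> 0) * F'' X (s *\<^sub>R X) + P' \<nu> (s *\<^sub>R X) * DF (\<kappa> 0) X)) (at 0)"
  proof (rule has_derivative_transform_within_open)
    show "((\<lambda>t. P \<nu> (\<kappa> t) * DF (\<kappa> t) X) has_derivative
        (\<lambda>s. P \<nu> (\<kappa> 0) * F'' X (s *\<^sub>R X) + P' \<nu> (s *\<^sub>R X) * DF (\<kappa> 0) X)) (at 0)"
      by (intro has_derivative_mult along P_der DF_der)
    show "P \<nu> (\<kappa> t) * DF (\<kappa> t) X = P X (\<kappa> t) * DF (\<kappa> t) \<nu>" if "t \<in> {-e<..<e}" for t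
      using proportional[of t] that by (simp add: abs_less_iff)
  qed (use \<kappa>(1) in auto)
  ultimately have "(\<lambda>s. P X (\<kappa> 0) * F'' \<nu> (s *\<^sub>R X) + P' X (s *\<^sub>R X) * DF (\<kappa> 0) \<nu>) =
      (\<lambda>s. P \<nu> (\<kappa> 0) * F'' X (s *\<^sub>R X) + P' \<nu> (s *\<^sub>R X) * DF (\<kappa> 0) X)"
    by (rule has_derivative_unique)
  from fun_cong[OF this, of 1] have "P' X X * differential A f p \<nu> = F'' X X"
    using DFX DF_y by (simp add: \<kappa>(2) PX P\<nu>)
  moreover have "P' X X = g p (L' X) X + (\<Sum>i\<in>UNIV. \<nu> $ i * G' X i X)"
    using metric_coord_expand[OF c(1) y_chart, of "L' X" X]
    by (simp only: P'_def sum.distrib Ly metric_y add.commute)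
  ultimately show ?thesis
    by (simp add: F''_def DF_def L'_def L_def G'_def)
qed

section \<open>Comparison of tangent domains\<close>

text \<open>The Christoffel terms of the two second fundamental forms agree because the normals do, so
  the comparison reduces to the derivatives of the components of the normal fields, hence to the
  Hessians of \<open>f / df(\<nu>)\<close> and \<open>h / dh(\<nu>)\<close>.  The difference of these two functions has a critical
  zero at \<open>p\<close>, and it is nonnegative on \<open>frontier E\<close>, where \<open>h = 0\<close> and, as \<open>D \<subseteq> E\<close>, \<open>f \<ge> 0\<close>.\<close>

lemma second_fundamental_form_mono:
  assumes nabla: "affine_connection A nabla"
    and f: "one_sided_defining_function A D W f" and h: "one_sided_defining_function A E Z h"
    and sub: "D \<subseteq> E" "open E"
    and p: "p \<in> W" "p \<in> Z" "p \<in> frontier D" "p \<in> frontier E"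
    and normals: "outward_unit_normal A g D p = outward_unit_normal A g E p"
    and X: "X \<in> tangent_space A (frontier D) p" "X \<in> tangent_space A (frontier E) p"
  shows "second_fundamental_form A g nabla E p X X \<le> second_fundamental_form A g nabla D p X X"
proof -
  define c where "c = chart_at A p"
  define \<nu> where "\<nu> = outward_unit_normal A g D p"
  define y where "y = snd c p"
  have c: "c \<in> A" "p \<in> fst c"
    by (simp_all add: c_def)
  note df = defining_functionD[OF one_sidedD(1)[OF f]] one_sidedD(2)[OF f]
  note dh = defining_functionD[OF one_sidedD(1)[OF h]] one_sidedD(2)[OF h]
  have f1: "Ck_fun A (Suc 1) W f" and h1: "Ck_fun A (Suc 1) Z h"
    using df(2) dh(2) by (simp_all add: numeral_2_eq_2)
  define DF where "DF z = frechet_derivative (f \<circ> chart_inv c) (at z)" for z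
  define DH where "DH z = frechet_derivative (h \<circ> chart_inv c) (at z)" for z
  let ?U = "snd c ` (fst c \<inter> (W \<inter> Z))"
  have yU: "y \<in> ?U"
    using c p by (simp add: y_def)
  have y_inv: "chart_inv c y = p"
    using c by (simp add: y_def)
  have DF_y: "DF y v = differential A f p v" and DH_y: "DH y v = differential A h p v" for v
    using differential_chart[OF f1 c p(1), of v] differential_chart[OF h1 c p(2), of v]
    by (simp_all add: DF_def DH_def y_def) (simp_all add: c_def)
  \<comment> \<open>As \<open>\<nu>\<close> is a unit vector, \<open>a = 1 / df(\<nu>)\<close> and \<open>b = 1 / dh(\<nu>)\<close>.\<close>
  obtain a where a: "a > 0" "\<And>v. g p \<nu> v = a * differential A f p v"
    using outward_unit_normal(2)[OF f p(1,3)] by (auto simp: \<nu>_def)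
  obtain b where b: "b > 0" "\<And>v. g p \<nu> v = b * differential A h p v"
    using outward_unit_normal(2)[OF h p(2,4)] by (auto simp: \<nu>_def normals)
  have "g p \<nu> \<nu> = 1"
    using outward_unit_normal(1)[OF f p(1,3)] by (simp add: \<nu>_def)
  then have a\<nu>: "differential A f p \<nu> * a = 1" and b\<nu>: "differential A h p \<nu> * b = 1"
    using a(2)[of \<nu>] b(2)[of \<nu>] by (simp_all add: mult.commute)
  define F'' where "F'' = frechet_derivative (\<lambda>z. DF z X) (at y) X"
  define H'' where "H'' = frechet_derivative (\<lambda>z. DH z X) (at y) X"
  have hessian: "b * H'' \<le> a * F''"
  proof -
    obtain e \<kappa> where \<kappa>: "e > (0::real)" "\<kappa> 0 = y" "(\<kappa> has_vector_derivative X) (at 0)"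
      "\<And>t. \<bar>t\<bar> < e \<Longrightarrow> \<kappa> t \<in> ?U \<and> chart_inv c (\<kappa> t) \<in> frontier E"
      by (rule tangent_vector_curve[OF X(2) open_Int[OF df(1) dh(1)] IntI[OF p(1,2)], folded c_def, folded y_def]) (rule that; simp)
    let ?k = "\<lambda>z. a * (f \<circ> chart_inv c) z - b * (h \<circ> chart_inv c) z"
    let ?k'' = "\<lambda>u v. a * frechet_derivative (\<lambda>z. DF z v) (at y) u -
      b * frechet_derivative (\<lambda>z. DH z v) (at y) u"
    have "0 \<le> ?k'' X X"
    proof (rule second_derivative_nonneg_along_curve[OF _ yU, where H = ?k and H'' = ?k''
          and H' = "\<lambda>z v. a * DF z v - b * DH z v", OF _ _ _ _ _ \<kappa>(2,3,1)])
      show "open ?U"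
        by (intro open_chart_image open_Int c df(1) dh(1))
      show "(?k has_derivative (\<lambda>v. a * DF z v - b * DH z v)) (at z)" if "z \<in> ?U" for z
        unfolding DF_def DH_def using that
        by (intro has_derivative_diff has_derivative_mult_right
            Ck_fun_has_derivative[OF f1 c(1)] Ck_fun_has_derivative[OF h1 c(1)]) auto
      show "((\<lambda>z. a * DF z v - b * DH z v) has_derivative (\<lambda>u. ?k'' u v)) (at y)" for v
      proof (intro has_derivative_diff has_derivative_mult_right C1_onD(1))
        show "Ck_on 1 (snd c ` (fst c \<inter> W)) (\<lambda>z. DF z v)" "Ck_on 1 (snd c ` (fst c \<inter> Z)) (\<lambda>z. DH z v)"
          unfolding DF_def DH_def using Ck_fun_chart[OF f1 c(1)] Ck_fun_chart[OF h1 c(1)] by simp_all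
      qed (use yU in auto)
      show "?k y = 0"
        using df(4)[OF p(1)] dh(4)[OF p(2)] p(3,4) by (simp add: y_inv)
      show "a * DF y v - b * DH y v = 0" for v
        using a(2)[of v] b(2)[of v] by (simp add: DF_y DH_y)
      show "0 \<le> ?k (\<kappa> t)" if t: "\<bar>t\<bar> < e" for t
      proof -
        define q where "q = chart_inv c (\<kappa> t)"
        have q: "q \<in> W" "q \<in> Z" "q \<in> frontier E"
          using \<kappa>(4)[OF t] in_chart_image[OF c(1)] by (auto simp: q_def)
        then have "q \<notin> D"
          using sub by (auto simp: frontier_def interior_open)
        then have "f q \<ge> 0" "h q = 0"
          using df(5)[OF q(1)] dh(4)[OF q(2)] q(3) by auto
        then show ?thesis
          using a(1) by (simp add: q_def)
      qed
    qed
    then show ?thesis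
      by (simp add: F''_def H''_def)
  qed
  define Nf where "Nf = normal_extension A g D p"
  define Nh where "Nh = normal_extension A g E p"
  obtain V where V: "open V" "p \<in> V" "Ck_field A 1 V Nf"
    "\<And>q. q \<in> V \<Longrightarrow> q \<in> frontier D \<Longrightarrow> Nf q = outward_unit_normal A g D q"
    unfolding Nf_def using normal_extension[OF f p(1)] by metis
  obtain V' where V': "open V'" "p \<in> V'" "Ck_field A 1 V' Nh"
    "\<And>q. q \<in> V' \<Longrightarrow> q \<in> frontier E \<Longrightarrow> Nh q = outward_unit_normal A g E q"
    unfolding Nh_def using normal_extension[OF h p(2)] by metis
  define K where "K = (\<Sum>i\<in>UNIV. \<nu> $ i * frechet_derivative (\<lambda>z. metric_coord c z (axis i 1) X) (at y) X)"
  define \<Gamma> where "\<Gamma> = (\<Sum>i\<in>UNIV. \<nu> $ i *\<^sub>R nabla p X (coord_field A c (axis i 1)))"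
  let ?Lf = "frechet_derivative (local_rep A c Nf) (at y) X"
  let ?Lh = "frechet_derivative (local_rep A c Nh) (at y) X"
  have cancel: "r = k * s" if "d * k = 1" "r * d = s" for r s d k :: real
    unfolding that(2)[symmetric] using that(1) by (simp add: mult.left_commute[of k] mult.commute[of k d])
  have "(g p ?Lf X + K) * differential A f p \<nu> = F''"
    using normal_derivative_hessian[OF f p(1,3) V X(1)]
    by (simp only: K_def F''_def DF_def c_def[symmetric] y_def[symmetric] \<nu>_def[symmetric])
  then have "g p ?Lf X + K = a * F''"
    by (rule cancel[OF a\<nu>])
  moreover have "(g p ?Lh X + K) * differential A h p \<nu> = H''"
    using normal_derivative_hessian[OF h p(2,4) V' X(2)]
    by (simp only: K_def H''_def DH_def c_def[symmetric] y_def[symmetric] normals[symmetric] \<nu>_def[symmetric])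
  then have "g p ?Lh X + K = b * H''"
    by (rule cancel[OF b\<nu>])
  moreover have "nabla p X Nf = ?Lf + \<Gamma>" "nabla p X Nh = ?Lh + \<Gamma>"
    using nabla_in_chart[OF nabla V(1-3)] nabla_in_chart[OF nabla V'(1-3)] V(4)[OF V(2) p(3)] V'(4)[OF V'(2) p(4)]
    by (simp_all only: c_def[symmetric] y_def[symmetric] normals[symmetric] \<nu>_def[symmetric] \<Gamma>_def)
  ultimately show ?thesis
    using hessian metric_bilinear[of p]
    by (simp add: second_fundamental_form_def Nf_def[symmetric] Nh_def[symmetric] bilinear_ladd)
qed

text \<open>Both normals are proportional to the differentials, which have the same kernel; the sign of
  the factor comes from \<open>D \<subseteq> E\<close>.\<close>

lemma outward_unit_normal_tangent_domains:
  assumes f: "one_sided_defining_function A D W f" and h: "one_sided_defining_function A E Z h"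
    and "D \<subseteq> E" and p: "p \<in> W" "p \<in> Z" "p \<in> frontier D" "p \<in> frontier E"
    and tangent: "tangent_space A (frontier D) p = tangent_space A (frontier E) p"
  shows "outward_unit_normal A g D p = outward_unit_normal A g E p"
proof -
  define \<nu> where "\<nu> = outward_unit_normal A g D p"
  have h1: "Ck_fun A (Suc 1) Z h"
    using defining_functionD(2)[OF one_sidedD(1)[OF h]] by (simp add: numeral_2_eq_2)
  have f1: "Ck_fun A (Suc 1) W f"
    using defining_functionD(2)[OF one_sidedD(1)[OF f]] by (simp add: numeral_2_eq_2)
  interpret f: linear "differential A f p"
    by (rule linear_differential[OF f1 p(1)])
  interpret h: linear "differential A h p"
    by (rule linear_differential[OF h1 p(2)])
  have kernel: "differential A f p v = 0 \<longleftrightarrow> differential A h p v = 0" for v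
    using tangent tangent_space_eq_kernel[OF one_sidedD(1)[OF f] p(1,3)]
      tangent_space_eq_kernel[OF one_sidedD(1)[OF h] p(2,4)] by blast
  obtain a where a: "a > 0" "\<And>v. g p \<nu> v = a * differential A f p v"
    using outward_unit_normal(2)[OF f p(1,3)] by (auto simp: \<nu>_def)
  have unit: "g p \<nu> \<nu> = 1"
    using outward_unit_normal(1)[OF f p(1,3)] by (simp add: \<nu>_def)
  have f\<nu>: "differential A f p \<nu> > 0"
    using a(1) a(2)[of \<nu>] unit by (metis zero_less_mult_pos zero_less_one)
  have "differential A h p \<nu> \<ge> 0"
    by (rule one_sided_differential_mono[OF f h assms(3) p f\<nu>])
  then have h\<nu>: "differential A h p \<nu> > 0"
    using kernel[of \<nu>] f\<nu> by linarith
  have "g p \<nu> v = inverse (differential A h p \<nu>) * differential A h p v" for v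
  proof -
    let ?k = "g p \<nu> v"
    have "differential A f p (v - ?k *\<^sub>R \<nu>) = 0"
      using a(1) a(2)[of v] a(2)[of \<nu>] unit by (simp add: f.diff f.scale algebra_simps)
    then have "differential A h p v = ?k * differential A h p \<nu>"
      using kernel[of "v - ?k *\<^sub>R \<nu>"] by (simp add: h.diff h.scale)
    then show ?thesis
      using h\<nu> by simp
  qed
  moreover have "inverse (differential A h p \<nu>) > 0"
    using h\<nu> by simp
  ultimately have "outward_unit_normal A g E p = \<nu>"
    by (intro outward_unit_normal_eq[OF h p(2,4) unit])
  then show ?thesis
    by (simp add: \<nu>_def)
qed

end

text \<open>The basis chosen in \<open>trace_on\<close> depends on \<open>b\<close> and \<open>T\<close> only, so both traces use the same one.\<close>

lemma trace_on_mono: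
  assumes "orthonormal_basis b T B" "\<And>e. e \<in> T \<Longrightarrow> q e e \<le> r e e"
  shows "trace_on b T q \<le> trace_on b T r"
  unfolding trace_on_def
proof (rule sum_mono)
  fix e assume "e \<in> (SOME B. orthonormal_basis b T B)"
  moreover have "orthonormal_basis b T (SOME B. orthonormal_basis b T B)"
    using assms(1) by (rule someI)
  ultimately show "q e e \<le> r e e"
    using assms(2) by (auto simp: orthonormal_basis_def intro: span_base)
qed

theorem mainTheorem3:
  fixes A :: "('a::{t2_space, second_countable_topology}, 'n::finite) chart set"
    and g :: "'a \<Rightarrow> real ^ 'n \<Rightarrow> real ^ 'n \<Rightarrow> real"
    and nabla :: "'a \<Rightarrow> real ^ 'n \<Rightarrow> ('a \<Rightarrow> real ^ 'n) \<Rightarrow> real ^ 'n"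
    and C \<Omega> :: "'a set" and x0 :: 'a
  assumes "smooth_atlas A" and "compact (UNIV :: 'a set)" and "connected (UNIV :: 'a set)"
    and "CARD('n) \<ge> 2"
    and "riemannian_metric A g" and "levi_civita A g nabla"
    and "C2_domain A C" and "C2_domain A \<Omega>" and "C \<subseteq> \<Omega>"
    and "x0 \<in> frontier C \<inter> frontier \<Omega>"
    and "tangent_space A (frontier C) x0 = tangent_space A (frontier \<Omega>) x0"
  shows "outward_unit_normal A g C x0 = outward_unit_normal A g \<Omega> x0 \<and>
    (\<forall>X\<in>tangent_space A (frontier C) x0.
       second_fundamental_form A g nabla \<Omega> x0 X X \<le> second_fundamental_form A g nabla C x0 X X) \<and>
    mean_curvature A g nabla \<Omega> x0 \<le> mean_curvature A g nabla C x0"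
proof -
  interpret riemannian_manifold A g
    using assms(1,5) by unfold_locales
  have x0: "x0 \<in> frontier C" "x0 \<in> frontier \<Omega>"
    using assms(10) by auto
  obtain W f where f: "x0 \<in> W" "one_sided_defining_function A C W f"
    using assms(7) x0(1) unfolding C2_domain_def by blast
  obtain Z h where h: "x0 \<in> Z" "one_sided_defining_function A \<Omega> Z h"
    using assms(8) x0(2) unfolding C2_domain_def by blast
  let ?T = "tangent_space A (frontier C) x0"
  let ?IIC = "second_fundamental_form A g nabla C x0"
  let ?II\<Omega> = "second_fundamental_form A g nabla \<Omega> x0"
  have normals: "outward_unit_normal A g C x0 = outward_unit_normal A g \<Omega> x0"
    by (rule outward_unit_normal_tangent_domains[OF f(2) h(2) assms(9) f(1) h(1) x0 assms(11)])
  have II: "?II\<Omega> X X \<le> ?IIC X X" if "X \<in> ?T" for X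
    using assms(6,8) that assms(11)
    by (intro second_fundamental_form_mono[OF _ f(2) h(2) assms(9) _ f(1) h(1) x0 normals])
       (auto simp: levi_civita_def C2_domain_def)
  have "subspace ?T"
  proof -
    have "Ck_fun A (Suc 1) W f"
      using defining_functionD(2)[OF one_sidedD(1)[OF f(2)]] by (simp add: numeral_2_eq_2)
    then show ?thesis
      using tangent_space_eq_kernel[OF one_sidedD(1)[OF f(2)] f(1) x0(1)] linear_subspace_kernel
        linear_differential f(1) by metis
  qed
  then obtain B where "orthonormal_basis (g x0) ?T B"
    using orthonormal_basis_exists[OF metric_bilinear metric_sym metric_pos] by blast
  then have "trace_on (g x0) ?T ?II\<Omega> \<le> trace_on (g x0) ?T ?IIC"
    using II by (rule trace_on_mono)
  then have "mean_curvature A g nabla \<Omega> x0 \<le> mean_curvature A g nabla C x0"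
    unfolding mean_curvature_def assms(11)[symmetric] using assms(4)
    by (intro mult_left_mono) auto
  then show ?thesis
    using normals II by blast
qed

end
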